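(* Assume that $0$ is a strongly conditionally unstable fixed point of the mapping $F$ and let $\mathcal D$ be the set of admissible disks defined in the context. Then there exists a smooth disk $N\subset W^{cu}_{loc}$ containing the point $0$ and such that for every $\varepsilon>0$ there exists $m(\varepsilon)\in\mathbb N$ with the following property: for every $m\ge m(\varepsilon)$ and every $D\in\mathcal D$ there exists an embedding $h_m$ of the disk $N$ into $\mathbb R^n$ such that $h_m(N)\subset F^m(D)$ and $\mathrm{dist}_1(h_m,\mathrm{id})<\varepsilon$.
   Context: $|\cdot|$ denotes the Euclidean norm and the corresponding operator norm; $\mathrm{dist}_1$ is the $C^1$ distance between maps, and $\mathrm{id}$ is the inclusion $N\to\mathbb R^n$. Diffeomorphism and manifolds. $F:\mathbb R^n\to\mathbb R^n$ is a $C^1$ diffeomorphism with $F(\overline Q)\subset Q$ for a bounded domain $Q\ni0$, $F(0)=0$, and $A=DF(0)$ has exactly $s\ge1$ eigenvalues (with multiplicity) of modulus $<1$ and $u=n-s$ eigenvalues of modulus $\ge1$, with corresponding invariant subspaces $\mathcal S$ and $\mathcal U$. $W^s_{loc}$ is the local stable manifold of $0$ (tangent to $\mathcal S$) and $W^{cu}_{loc}$ is a local center unstable manifold of $0$ (a locally invariant $C^1$ manifold tangent to $\mathcal U$ at $0$, obtained as the local part of the pseudohyperbolic invariant manifold, in the sense of Hirsch–Pugh–Shub, of a $C^1$ extension of $F$ near $0$ that is Lipschitz-close to $A$). $W^\sigma=\bigcup_{k\in\mathbb Z}F^k(W^\sigma_{loc})$, $\sigma\in\{s,cu\}$. Strong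 conditional instability. $0$ is strongly conditionally unstable if $W^{cu}_{loc}$ can be chosen so that: 1) there exist a neighborhood $O$ of the origin and a continuous $V:O\to[0,+\infty)$ such that $V(x)=0$ if and only if $x\in W^s_{loc}$, and $V(F(x))\ge V(x)$ for all $x\in O\cap F^{-1}(O)$; 2) the fixed point $0$ of $F^{-1}|_{W^{cu}_{loc}}$ is asymptotically stable. This $W^{cu}_{loc}$ is used. Homoclinic point and coordinates. There exist disks $w^{cu}\subset W^{cu}$ and $w^s\subset W^s$ that intersect transversally at a point $p\ne0$. Coordinates $x=(y,z)$, $y\in\mathbb R^s$, $z\in\mathbb R^u$, are chosen so that $A=\operatorname{diag}(B,C)$ with $|B|=a_0<1$ and $b_0=1/|C^{-1}|>a_0$, $\mathcal S=\{(y,0)\}$, $\mathcal U=\{(0,z)\}$, $W^s_{loc}\subset\mathcal S$, $W^{cu}_{loc}\subset\mathcal U$, and $p=(y_p,0)\in W^s_{loc}$. $U^0$ is a neighborhood of $0$ so small that $p\notin\overline{U^0}$, $W^s_{loc}\cap U^0=\{(y,0)\in U^0\}$ and $W^{cu}_{loc}\cap U^0=\{(0,z)\in U^0\}$. In a neighborhood $U^1$ of $p$, $U^0\cap U^1=\emptyset$, one uses $C^1$ coordinates, denoted $(y,z')\in\mathbb R^s\times\mathbb R^u$ and related to the standard ones by a smooth change of variables, in which $p=(y_p,0)$, a small disk in $w^{cu}$ containing $p$ is given by $y=y_p$, and $W^s_{loc}$ near $p$ is given by $z'=0$. Admissible disks. For positive $\varepsilon^y_0,\varepsilon^z_0,\varepsilon^y_1,\varepsilon^z_1$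 so small that $U_i\subset U^i$, put $U_0=\{|y|\le\varepsilon^y_0,\ |z|\le\varepsilon^z_0\}$ and $U_1=\{|y-y_p|\le\varepsilon^y_1,\ |z'|\le\varepsilon^z_1\}$. An admissible disk at $U_0$ is a set $\{(\eta(z),z):|z|\le\varepsilon^z_0\}$, where $\eta$ is $C^1$, $\max_{|z|\le\varepsilon^z_0}|\eta(z)|\le\varepsilon^y_0$ and $\max_{|z|\le\varepsilon^z_0}|D\eta(z)|\le1$. An admissible disk at $U_1$ is a set given in the coordinates $(y,z')$ by $\{(\eta(z'),z'):|z'|\le\varepsilon^z_1\}$, where $\eta$ is $C^1$, $\max_{|z'|\le\varepsilon^z_1}|\eta(z')-y_p|\le\varepsilon^y_1$ and $\max_{|z'|\le\varepsilon^z_1}|D\eta(z')|\le1$. $\mathcal D_i$ is the set of disks admissible at $U_i$, $i=0,1$, and $\mathcal D=\mathcal D_0\cup\mathcal D_1$. *)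

theory Defs
  imports "HOL-Analysis.Analysis" "HOL-Computational_Algebra.Polynomial"
begin

text \<open>
  The phase space \<open>\<real>\<^sup>n\<close>, \<open>n = s + u\<close>, is \<open>(real^'s) \<times> (real^'u)\<close> with points \<open>x = (y, z)\<close>.  The norm of
  the product type is the Euclidean one, and \<open>s = CARD('s)\<close>, \<open>u = CARD('u)\<close>.
\<close>

type_synonym ('s, 'u) phase = "(real^'s) \<times> (real^'u)"

section \<open>\<open>C\<^sup>1\<close> maps, tangent spaces, disks and submanifolds\<close>

text \<open>
  On a set that is not open, derivatives are taken within the set.  This covers closed balls and
  closed disks of positive codimension; in the latter case the derivative is determined only on
  the tangent space.
\<close>

definition C1_on :: "'a::real_normed_vector set \<Rightarrow> ('a \<Rightarrow> 'b::real_normed_vector) \<Rightarrow> bool" where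
  "C1_on M f \<longleftrightarrow> (\<exists>f' :: 'a \<Rightarrow> 'a \<Rightarrow>\<^sub>L 'b. continuous_on M f' \<and>
     (\<forall>x\<in>M. (f has_derivative blinfun_apply (f' x)) (at x within M)))"

definition C1_diffeo_on :: "'a::real_normed_vector set \<Rightarrow> ('a \<Rightarrow> 'b::real_normed_vector) \<Rightarrow> bool" where
  "C1_diffeo_on M f \<longleftrightarrow> open M \<and> open (f ` M) \<and> inj_on f M \<and>
     C1_on M f \<and> C1_on (f ` M) (the_inv_into M f)"

text \<open>
  The span of the one-sided velocities of curves in \<open>M\<close> starting at \<open>x\<close>.  One-sided velocities
  make this the full tangent space also at the boundary points of a disk.
\<close>

definition tangent_space :: "'a::real_normed_vector set \<Rightarrow> 'a \<Rightarrow> 'a set" where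
  "tangent_space M x = span {v. \<exists>\<gamma>::real \<Rightarrow> 'a. \<gamma> 0 = x \<and> (\<forall>t\<in>{0..1}. \<gamma> t \<in> M) \<and>
     (\<gamma> has_vector_derivative v) (at 0 within {0..1})}"

definition C1_embedding :: "'a::real_normed_vector set \<Rightarrow> ('a \<Rightarrow> 'b::real_normed_vector) \<Rightarrow> bool" where
  "C1_embedding M f \<longleftrightarrow> C1_on M f \<and> (\<exists>g. homeomorphism M (f ` M) f g) \<and>
     (\<forall>x\<in>M. inj_on (frechet_derivative f (at x within M)) (tangent_space M x))"

text \<open>
  The \<open>C\<^sup>1\<close> distance of two maps defined on \<open>M\<close>: differentials are compared as linear maps on the
  tangent spaces of \<open>M\<close>.  On tangent vectors \<open>frechet_derivative f (at x within M)\<close> does not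
  depend on the choice of a derivative.
\<close>

definition C1_dist :: "'a::real_normed_vector set \<Rightarrow> ('a \<Rightarrow> 'b::real_normed_vector) \<Rightarrow> ('a \<Rightarrow> 'b) \<Rightarrow> real" where
  "C1_dist M f g = (SUP x\<in>M. norm (f x - g x)) +
     (SUP x\<in>M. SUP v\<in>{v \<in> tangent_space M x. norm v \<le> 1}.
        norm (frechet_derivative f (at x within M) v - frechet_derivative g (at x within M) v))"

definition C1_disk :: "nat \<Rightarrow> 'a::euclidean_space set \<Rightarrow> bool" where
  "C1_disk d D \<longleftrightarrow> (\<exists>(L::'a set) (h::'a \<Rightarrow> 'a). subspace L \<and> dim L = d \<and>
     C1_embedding (L \<inter> cball 0 1) h \<and> D = h ` (L \<inter> cball 0 1))"

definition C1_submanifold :: "nat \<Rightarrow> 'a::euclidean_space set \<Rightarrow> bool" where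
  "C1_submanifold d M \<longleftrightarrow> (\<forall>x\<in>M. \<exists>G (\<phi>::'a \<Rightarrow> 'a) L. x \<in> G \<and> C1_diffeo_on G \<phi> \<and>
     subspace L \<and> dim L = d \<and> \<phi> ` (M \<inter> G) = L \<inter> \<phi> ` G)"

definition transversal_at :: "'a::real_normed_vector set \<Rightarrow> 'a set \<Rightarrow> 'a \<Rightarrow> bool" where
  "transversal_at M N p \<longleftrightarrow> p \<in> M \<and> p \<in> N \<and>
     (\<forall>x. \<exists>v\<in>tangent_space M p. \<exists>w\<in>tangent_space N p. x = v + w)"

section \<open>Eigenvalues and spectral subspaces of a linear map\<close>

definition phase_vec :: "('s::finite, 'u::finite) phase \<Rightarrow> real^('s + 'u)" where
  "phase_vec x = (\<chi> i. case i of Inl a \<Rightarrow> fst x $ a | Inr b \<Rightarrow> snd x $ b)"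

definition vec_phase :: "real^('s::finite + 'u::finite) \<Rightarrow> ('s, 'u) phase" where
  "vec_phase w = ((\<chi> a. w $ Inl a), (\<chi> b. w $ Inr b))"

definition complex_matrix ::
    "(('s::finite, 'u::finite) phase \<Rightarrow> ('s, 'u) phase) \<Rightarrow> complex^('s + 'u)^('s + 'u)" where
  "complex_matrix A = (\<chi> i j. complex_of_real (matrix (phase_vec \<circ> A \<circ> vec_phase) $ i $ j))"

definition charpoly :: "complex^'n::finite^'n \<Rightarrow> complex poly" where
  "charpoly M = det (\<chi> i j. (if i = j then [:0, 1:] else 0) - [:M $ i $ j:])"

text \<open>Number of eigenvalues with property \<open>P\<close>, counted with algebraic multiplicity.\<close>

definition eigenvalue_count ::
    "(('s::finite, 'u::finite) phase \<Rightarrow> ('s, 'u) phase) \<Rightarrow> (complex \<Rightarrow> bool) \<Rightarrow> nat" where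
  "eigenvalue_count A P =
     (\<Sum>l | poly (charpoly (complex_matrix A)) l = 0 \<and> P l. order l (charpoly (complex_matrix A)))"

text \<open>
  The real vectors in the sum of the complex generalized eigenspaces for the eigenvalues with
  property \<open>P\<close>; \<open>P\<close> is meant to be invariant under complex conjugation.
\<close>

definition spectral_subspace ::
    "(('s::finite, 'u::finite) phase \<Rightarrow> ('s, 'u) phase) \<Rightarrow> (complex \<Rightarrow> bool) \<Rightarrow> ('s, 'u) phase set" where
  "spectral_subspace A P = {x. (\<chi> i. complex_of_real (phase_vec x $ i)) \<in>
     vec.span {w. \<exists>l k. P l \<and> (((*v) (complex_matrix A - mat l)) ^^ k) w = 0}}"

section \<open>Invariant manifolds of the fixed point \<open>0\<close>\<close>

text \<open>
  All eigenvalues of modulus \<open>\<ge> 1\<close> are excluded from the stable directions, so the local stable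
  manifold consists of the points whose orbits stay in a neighborhood \<open>G\<close> of \<open>0\<close> and converge to
  \<open>0\<close> exponentially.
\<close>

definition local_stable_manifold ::
    "('a::euclidean_space \<Rightarrow> 'a) \<Rightarrow> 'a set \<Rightarrow> 'a set \<Rightarrow> bool" where
  "local_stable_manifold F S W \<longleftrightarrow>
     C1_submanifold (dim S) W \<and> 0 \<in> W \<and> tangent_space W 0 = S \<and>
     (\<exists>G q. open G \<and> 0 \<in> G \<and> 0 < q \<and> q < 1 \<and>
        W = {x. (\<forall>k. (F ^^ k) x \<in> G) \<and> (\<exists>c. \<forall>k. norm ((F ^^ k) x) \<le> c * q ^ k)})"

text \<open>
  The pseudohyperbolic invariant manifold of Hirsch, Pugh and Shub tangent to the expanding factor:
  the intersection of the forward images of the cone \<open>{(y, z). \<bar>y\<bar> \<le> \<bar>z\<bar>}\<close>.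
\<close>

definition pseudohyperbolic_manifold ::
    "(('s::finite, 'u::finite) phase \<Rightarrow> ('s, 'u) phase) \<Rightarrow> ('s, 'u) phase set" where
  "pseudohyperbolic_manifold f = (\<Inter>k. (f ^^ k) ` {(y, z). norm y \<le> norm z})"

text \<open>
  A local center unstable manifold for \<open>DF(0) = diag(B, C)\<close>.  With \<open>a\<^sub>0 = onorm B\<close> and
  \<open>b\<^sub>0 = 1 / onorm (inv C)\<close>, an extension \<open>f\<close> whose distance to the linear part has Lipschitz
  constant \<open>L\<close> with \<open>4 L < b\<^sub>0 - a\<^sub>0\<close> is close enough for the graph transform underlying the
  Hirsch-Pugh-Shub theorem to be a contraction.  Local invariance of \<open>W\<close> is a consequence: if
  \<open>x \<in> W\<close> and \<open>F x \<in> G\<close>, then \<open>F x = f x \<in> W\<close>.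
\<close>

definition local_center_unstable_manifold ::
    "(('s::finite, 'u::finite) phase \<Rightarrow> ('s, 'u) phase) \<Rightarrow> (real^'s \<Rightarrow> real^'s) \<Rightarrow> (real^'u \<Rightarrow> real^'u) \<Rightarrow>
     ('s, 'u) phase set \<Rightarrow> bool" where
  "local_center_unstable_manifold F B C W \<longleftrightarrow>
     (\<exists>f g G L. open G \<and> 0 \<in> G \<and> C1_on UNIV f \<and> (\<forall>x\<in>G. f x = F x) \<and>
        L-lipschitz_on UNIV (\<lambda>x. f x - map_prod B C x) \<and> 4 * L < 1 / onorm (inv C) - onorm B \<and>
        C1_on UNIV g \<and> g 0 = 0 \<and> (g has_derivative (\<lambda>_. 0)) (at 0) \<and>
        pseudohyperbolic_manifold f = {(g z, z) |z. True} \<and>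
        f ` pseudohyperbolic_manifold f = pseudohyperbolic_manifold f \<and>
        W = pseudohyperbolic_manifold f \<inter> G)"

text \<open>\<open>\<Union>\<^sub>k F\<^sup>k(W)\<close> over all integers \<open>k\<close>.\<close>

definition global_manifold :: "('a \<Rightarrow> 'a) \<Rightarrow> 'a set \<Rightarrow> 'a set" where
  "global_manifold F W = (\<Union>k. (F ^^ k) ` W) \<union> (\<Union>k. (inv F ^^ k) ` W)"

text \<open>
  Asymptotic stability of the fixed point \<open>0\<close> of \<open>H\<close> restricted to \<open>W\<close>.  As \<open>W\<close> is only locally
  invariant, part of the condition is that orbits starting in \<open>W\<close> close to \<open>0\<close> stay in \<open>W\<close>.
\<close>

definition asymptotically_stable_on ::
    "('a::real_normed_vector \<Rightarrow> 'a) \<Rightarrow> 'a set \<Rightarrow> bool" where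
  "asymptotically_stable_on H W \<longleftrightarrow>
     (\<forall>e>0. \<exists>d>0. \<forall>x\<in>W \<inter> ball 0 d. \<forall>k. (H ^^ k) x \<in> W \<inter> ball 0 e) \<and>
     (\<exists>d>0. \<forall>x\<in>W \<inter> ball 0 d. (\<lambda>k. (H ^^ k) x) \<longlonglongrightarrow> 0)"

text \<open>
  Strong conditional instability of \<open>0\<close>, witnessed by the local center unstable manifold \<open>Wcu\<close>.
\<close>

definition strongly_conditionally_unstable ::
    "('a::real_normed_vector \<Rightarrow> 'a) \<Rightarrow> 'a set \<Rightarrow> 'a set \<Rightarrow> bool" where
  "strongly_conditionally_unstable F Ws Wcu \<longleftrightarrow>
     (\<exists>G V. open G \<and> 0 \<in> G \<and> continuous_on G V \<and>
        (\<forall>x\<in>G. (0::real) \<le> V x) \<and> (\<forall>x\<in>G. V x = 0 \<longleftrightarrow> x \<in> Ws) \<and>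
        (\<forall>x\<in>G \<inter> F -` G. V x \<le> V (F x))) \<and>
     asymptotically_stable_on (inv F) Wcu"

section \<open>Admissible disks\<close>

definition graph_disks ::
    "real^'s::finite \<Rightarrow> real \<Rightarrow> real \<Rightarrow> (('s, 'u::finite) phase) set set" where
  "graph_disks c ey ez = {(\<lambda>z. (\<eta> z, z)) ` cball 0 ez |\<eta>. C1_on (cball 0 ez) \<eta> \<and>
     (\<forall>z\<in>cball 0 ez. norm (\<eta> z - c) \<le> ey) \<and>
     (\<forall>z\<in>cball 0 ez. onorm (frechet_derivative \<eta> (at z within cball 0 ez)) \<le> 1)}"

text \<open>
  \<open>\<phi>\<close> is the coordinate map \<open>x \<mapsto> (y, z')\<close> on the neighborhood \<open>G1\<close> of the homoclinic point
  \<open>(y\<^sub>p, 0)\<close>.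
\<close>

definition admissible_disks ::
    "('s::finite, 'u::finite) phase set \<Rightarrow> (('s, 'u) phase \<Rightarrow> ('s, 'u) phase) \<Rightarrow> real^'s \<Rightarrow>
     real \<Rightarrow> real \<Rightarrow> real \<Rightarrow> real \<Rightarrow> ('s, 'u) phase set set" where
  "admissible_disks G1 \<phi> yp ey0 ez0 ey1 ez1 =
     graph_disks 0 ey0 ez0 \<union> {{x \<in> G1. \<phi> x \<in> d} |d. d \<in> graph_disks yp ey1 ez1}"

end

theory Submission
  imports Defs
begin

text \<open>
  This is an inclination lemma in which the unstable direction need not expand.  Write points as
  \<open>(y, z)\<close>; \<open>W\<^sup>s\<close> is locally the \<open>y\<close>-axis, \<open>W\<^sup>c\<^sup>u\<close> locally the \<open>z\<close>-axis, and \<open>F\<close> is differentiable at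
  \<open>0\<close> with \<open>DF(0) = diag(B, C)\<close>, \<open>|B| = a < 1\<close>, \<open>|C z| \<ge> b |z|\<close>, \<open>a < b\<close>.  The number \<open>b\<close> may be
  smaller than \<open>1\<close>, so the iterates of a disk could shrink in the \<open>z\<close>-direction.

  The size of the iterates is controlled by the function \<open>V\<close>, which vanishes exactly on \<open>W\<^sup>s\<close> and does
  not decrease along orbits.  Suppose that near \<open>0\<close> a disk is transversal to the \<open>y\<close>-axis and reaches
  up to height \<open>|z| = d\<close>.  On the collar \<open>d \<le> |z|\<close> of a compact box around \<open>0\<close>, \<open>V\<close> has a positive
  minimum \<open>v\<^sub>0\<close>, while \<open>V < v\<^sub>0\<close> near \<open>0\<close>.  A point of a late iterate that lies at height at most \<open>\<rho>\<close>
  is close to \<open>0\<close>, because the intersection of the iterate with the \<open>y\<close>-axis converges to \<open>0\<close> and the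
  slope of the iterate is at most one.  Its backward orbit inside the iterated disks can leave \<open>|z| < d\<close> only through
  the collar, and this would contradict the monotonicity of \<open>V\<close>.  So the part of every late iterate at
  heights \<open>|z| \<le> \<rho>\<close> comes from orbits that remained in the box, with \<open>\<rho>\<close> independent of the number of
  iterations (\<open>small_height_confines_orbit\<close>).  Along such orbits \<open>|y|\<close> tends to \<open>0\<close> geometrically, and
  so does the influence of the off-diagonal block \<open>\<partial>\<^sub>z F\<^sub>y\<close>, which vanishes on the \<open>z\<close>-axis.  Tangent
  vectors of slope at most one therefore end with arbitrarily small slope, since \<open>a < b\<close>
  (\<open>cone_slopes_vanish\<close>).  Both statements together give \<open>C\<^sup>1\<close> convergence to the \<open>z\<close>-axis over
  \<open>|z| \<le> \<rho>\<close> (\<open>steep_curves_accumulate\<close>).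

  That the iterated disk covers the whole ball \<open>|z| \<le> \<rho>\<close> is seen with the globally defined extension
  \<open>f\<close> of \<open>F\<close> from the definition of \<open>W\<^sup>c\<^sup>u\<close>.  A disk is first continued to a map \<open>e\<close> defined on all of
  \<open>\<real>\<^sup>u\<close> whose secants have slope at most one.  Since \<open>f\<close> is Lipschitz close to \<open>diag(B, C)\<close>, it
  preserves this property, and the height of \<open>f\<^sup>k \<circ> e\<close> is a continuous map of \<open>\<real>\<^sup>u\<close> with
  a lower Lipschitz bound.  By invariance of domain such a map is a bijection, and its
  inverse parametrizes the iterate as a graph.

  Admissible disks enter this picture through their intersection point with \<open>W\<^sup>s\<close>, both at \<open>0\<close> and,
  in the coordinates \<open>\<phi>\<close>, at the homoclinic point.  The intersection points lie in a compact subset of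
  \<open>W\<^sup>s\<close>, so one common number of iterations brings all of them close to \<open>0\<close>.  The derivatives of the
  iterates preserve \<open>T W\<^sup>s\<close> and are injective, hence vectors transversal to \<open>W\<^sup>s\<close> remain so, and
  domination makes them steep after a further common number of steps.  By uniform continuity of the
  derivative this persists on a disk around the intersection point whose size is the same for all
  admissible disks (\<open>disks_through_stable_set_become_steep\<close>).
\<close>

section \<open>Differential calculus preliminaries\<close>

lemma norm_le_sum_components:
  fixes x :: "'a::real_normed_vector \<times> 'b::real_normed_vector"
  shows "norm x \<le> norm (fst x) + norm (snd x)"
  using norm_triangle_ineq[of "(fst x, 0)" "(0, snd x)"] by (simp add: norm_Pair)

lemma norm_component_le:
  fixes x :: "'a::real_normed_vector \<times> 'b::real_normed_vector"
  shows "norm (fst x) \<le> norm x" "norm (snd x) \<le> norm x"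
  by (metis norm_fst_le prod.collapse, metis norm_snd_le prod.collapse)

lemma compact_continuous_pos_bound:
  fixes f :: "'a::topological_space \<Rightarrow> real"
  assumes "compact S" "continuous_on S f" "\<And>x. x \<in> S \<Longrightarrow> 0 < f x"
  shows "\<exists>c>0. \<forall>x\<in>S. c \<le> f x"
proof (cases "S = {}")
  case True then show ?thesis by (auto intro: exI[of _ 1])
next
  case False
  then obtain x where "x \<in> S" "\<And>y. y \<in> S \<Longrightarrow> f x \<le> f y"
    using continuous_attains_inf[OF assms(1) _ assms(2)] by blast
  then show ?thesis using assms(3) by blast
qed

text \<open>
  If \<open>h \<circ> f\<close> is constant along the affine subspace \<open>x + range l\<close>, then \<open>h \<circ> f'\<close> kills its directions.
  Applied to invariant axes, this makes one block of a derivative vanish.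
\<close>

lemma has_derivative_constant_direction:
  assumes f: "(f has_derivative f') (at x)" and "open S" "x \<in> S"
    and h: "bounded_linear h" and l: "bounded_linear l"
    and const: "\<And>t. x + l t \<in> S \<Longrightarrow> h (f (x + l t)) = h (f x)"
  shows "h (f' (l v)) = 0"
proof -
  have "((\<lambda>t. x + l t) has_derivative l) (at 0)"
    using has_derivative_add[OF has_derivative_const bounded_linear_imp_has_derivative[OF l], of x "at 0"]
    by simp
  moreover have "(f has_derivative f') (at (x + l 0))"
    using f linear_0[OF bounded_linear.linear[OF l]] by simp
  ultimately have "(f \<circ> (\<lambda>t. x + l t) has_derivative (f' \<circ> l)) (at 0)"
    by (rule diff_chain_at)
  then have 1: "((\<lambda>t. h (f (x + l t))) has_derivative (\<lambda>t. h (f' (l t)))) (at 0)"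
    using bounded_linear.has_derivative[OF h] by (fastforce simp: o_def)
  have "continuous_on UNIV (\<lambda>t. x + l t)"
    by (intro continuous_intros linear_continuous_on l)
  then have "open ((\<lambda>t. x + l t) -` S)" using \<open>open S\<close> by (rule open_vimage[rotated])
  moreover have "0 \<in> (\<lambda>t. x + l t) -` S" using \<open>x \<in> S\<close> linear_0[OF bounded_linear.linear[OF l]] by simp
  ultimately have "((\<lambda>t. h (f x)) has_derivative (\<lambda>t. h (f' (l t)))) (at 0)"
    using has_derivative_transform_within_open[OF 1, of _ "\<lambda>t. h (f x)"] const by auto
  then have "(\<lambda>t. h (f' (l t))) = (\<lambda>_. 0)"
    using has_derivative_unique has_derivative_const by blast
  then show ?thesis by (rule fun_cong)
qed

text \<open>
  Increments that are comparable in norm have comparable derivatives.  This transfers secant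
  estimates to tangent vectors.
\<close>

lemma derivative_norm_le:
  assumes f: "(f has_derivative f') (at x)" and g: "(g has_derivative g') (at x)"
    and le: "\<And>y. norm (f y - f x) \<le> norm (g y - g x)"
  shows "norm (f' v) \<le> norm (g' v)"
proof (cases "v = 0")
  case True
  then show ?thesis using linear_0[OF has_derivative_linear[OF f]] by simp
next
  case False
  have small: "norm (f' v) \<le> norm (g' v) + e * norm v + e * norm v" if "0 < e" for e
  proof -
    obtain d1 where d1: "0 < d1" "\<And>y. norm (y - x) < d1 \<Longrightarrow> norm (f y - f x - f' (y - x)) \<le> e * norm (y - x)"
      using f \<open>0 < e\<close> unfolding has_derivative_at_alt by blast
    obtain d2 where d2: "0 < d2" "\<And>y. norm (y - x) < d2 \<Longrightarrow> norm (g y - g x - g' (y - x)) \<le> e * norm (y - x)"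
      using g \<open>0 < e\<close> unfolding has_derivative_at_alt by blast
    define t where "t = min d1 d2 / (2 * norm v)"
    have t0: "0 < t" using d1(1) d2(1) False by (simp add: t_def)
    have tn: "norm (t *\<^sub>R v) = min d1 d2 / 2" using False d1(1) d2(1) by (simp add: t_def)
    then have t: "norm (t *\<^sub>R v) < d1" "norm (t *\<^sub>R v) < d2"
      using d1(1) d2(1) by linarith+
    let ?y = "x + t *\<^sub>R v"
    have "norm (f' (t *\<^sub>R v)) \<le> norm (f ?y - f x) + norm (f ?y - f x - f' (t *\<^sub>R v))"
      using norm_triangle_ineq4[of "f ?y - f x" "f ?y - f x - f' (t *\<^sub>R v)"] by simp
    also have "\<dots> \<le> norm (g ?y - g x) + e * norm (t *\<^sub>R v)"
      using d1(2)[of ?y] t le[of ?y] by simp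
    also have "norm (g ?y - g x) \<le> norm (g' (t *\<^sub>R v)) + norm (g ?y - g x - g' (t *\<^sub>R v))"
      using norm_triangle_ineq[of "g' (t *\<^sub>R v)" "g ?y - g x - g' (t *\<^sub>R v)"] by simp
    also have "norm (g ?y - g x - g' (t *\<^sub>R v)) \<le> e * norm (t *\<^sub>R v)"
      using d2(2)[of ?y] t by simp
    finally have "norm (f' (t *\<^sub>R v)) \<le> norm (g' (t *\<^sub>R v)) + e * norm (t *\<^sub>R v) + e * norm (t *\<^sub>R v)"
      by simp
    then have "t * norm (f' v) \<le> t * (norm (g' v) + e * norm v + e * norm v)"
      using t0 linear_cmul[OF has_derivative_linear[OF f]] linear_cmul[OF has_derivative_linear[OF g]]
      by (simp add: algebra_simps)
    then show ?thesis using t0 by (simp only: mult_le_cancel_left_pos)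
  qed
  show ?thesis
  proof (rule field_le_epsilon)
    fix e :: real assume "0 < e"
    then have "norm (f' v) \<le> norm (g' v) + e / (2 * norm v) * norm v + e / (2 * norm v) * norm v"
      using False by (intro small) simp
    then show "norm (f' v) \<le> norm (g' v) + e" using False by simp
  qed
qed

lemma expanding_inj:
  assumes "0 < c" "\<And>x y. c * norm (x - y) \<le> norm (g x - g y)"
  shows "inj g"
proof (rule injI)
  fix x y assume "g x = g y"
  then have "c * norm (x - y) \<le> 0" using assms(2)[of x y] by simp
  then show "x = y" using \<open>0 < c\<close> by (simp add: mult_le_0_iff)
qed

text \<open>
  The image is open by invariance of domain, and it is closed because preimages of Cauchy sequences
  are Cauchy; so it is the whole space.
\<close>

lemma expanding_bij:
  fixes g :: "'a::euclidean_space \<Rightarrow> 'a"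
  assumes c: "0 < c" and exp: "\<And>x y. c * norm (x - y) \<le> norm (g x - g y)"
    and cont: "continuous_on UNIV g"
  shows "bij g"
proof -
  have inj: "inj g" using expanding_inj[OF c exp] .
  have "open (range g)" using invariance_of_domain[OF cont open_UNIV inj] .
  moreover have "closed (range g)"
    unfolding closed_sequential_limits
  proof (intro allI impI, elim conjE)
    fix X l assume X: "\<forall>n. X n \<in> range g" and l: "X \<longlonglongrightarrow> l"
    then have "\<exists>w. \<forall>n. X n = g (w n)" by (intro choice) blast
    then obtain w where w: "\<And>n. X n = g (w n)" by blast
    have "Cauchy w"
    proof (rule CauchyI)
      fix e :: real assume "0 < e"
      then obtain M where M: "\<And>m n. m \<ge> M \<Longrightarrow> n \<ge> M \<Longrightarrow> norm (X m - X n) < c * e"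
        using CauchyD[OF LIMSEQ_imp_Cauchy[OF l], of "c * e"] c by auto
      have "norm (w m - w n) < e" if "m \<ge> M" "n \<ge> M" for m n
      proof -
        have "c * norm (w m - w n) < c * e"
          using M[OF that] exp[of "w m" "w n"] by (simp add: w)
        then show ?thesis using c by (simp only: mult_less_cancel_left_pos)
      qed
      then show "\<exists>M. \<forall>m\<ge>M. \<forall>n\<ge>M. norm (w m - w n) < e" by blast
    qed
    then obtain v where "w \<longlonglongrightarrow> v" using Cauchy_convergent convergent_def by blast
    then have "(\<lambda>n. g (w n)) \<longlonglongrightarrow> g v"
      using cont by (metis UNIV_I continuous_on_tendsto_compose eventually_sequentiallyI)
    then have "l = g v" using l w LIMSEQ_unique by (metis (no_types, lifting) ext)
    then show "l \<in> range g" by blast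
  qed
  ultimately have "range g = UNIV" using clopen[of "range g"] by blast
  then show ?thesis using inj by (simp add: bij_def)
qed

text \<open>
  The derivative \<open>\<Gamma>\<close> of the inverse is continuous because the lower bound \<open>c\<close> passes from \<open>g\<close> to \<open>g'\<close>
  and the resolvent identity \<open>P\<^sup>-\<^sup>1 - Q\<^sup>-\<^sup>1 = P\<^sup>-\<^sup>1 (Q - P) Q\<^sup>-\<^sup>1\<close> then bounds the variation of \<open>\<Gamma>\<close> by
  \<open>c\<^sup>-\<^sup>2\<close> times that of \<open>g'\<close>.
\<close>

lemma expanding_inverse_C1:
  fixes g :: "'a::euclidean_space \<Rightarrow> 'a"
  assumes c: "0 < c" and exp: "\<And>x y. c * norm (x - y) \<le> norm (g x - g y)"
    and cont: "continuous_on UNIV g" and "open W"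
    and der: "\<And>w. w \<in> W \<Longrightarrow> (g has_derivative blinfun_apply (g' w)) (at w)"
    and g': "continuous_on W g'"
  shows "\<exists>\<Gamma>. continuous_on (g ` W) \<Gamma> \<and>
           (\<forall>z\<in>g ` W. (inv g has_derivative blinfun_apply (\<Gamma> z)) (at z) \<and> (\<forall>v. g' (inv g z) (\<Gamma> z v) = v))"
proof -
  have "bij g" using expanding_bij[OF c exp cont] .
  then have surj: "\<And>z. g (inv g z) = z" and inj: "\<And>w. inv g (g w) = w"
    by (auto simp: bij_def surj_f_inv_f)
  have lip: "norm (inv g x - inv g y) \<le> norm (x - y) / c" for x y
    using exp[of "inv g x" "inv g y"] c by (simp add: surj field_simps)
  have contI: "continuous_on UNIV (inv g)"
  proof -
    have "(1/c)-lipschitz_on UNIV (inv g)"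
      using lip c by (intro lipschitz_onI) (auto simp: dist_norm)
    then show ?thesis by (rule lipschitz_on_continuous_on)
  qed
  have low: "c * norm v \<le> norm (g' w v)" if w: "w \<in> W" for w v
  proof -
    have "((\<lambda>w. c *\<^sub>R w) has_derivative (\<lambda>v. c *\<^sub>R v)) (at w)"
      by (rule bounded_linear_imp_has_derivative[OF bounded_linear_scaleR_right])
    then have "norm (c *\<^sub>R v) \<le> norm (g' w v)"
      using der[OF w] by (rule derivative_norm_le) (use exp c in \<open>simp flip: scaleR_diff_right\<close>)
    then show ?thesis using c by simp
  qed
  have bijD: "bij (blinfun_apply (g' w))" if "w \<in> W" for w
  proof -
    have "inj (blinfun_apply (g' w))"
      using expanding_inj[OF c, of "blinfun_apply (g' w)"] low[OF that] by (simp flip: blinfun.diff_right)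
    then show ?thesis
      using linear_inj_imp_surj[OF bounded_linear.linear[OF blinfun.bounded_linear_right]]
      by (simp add: bij_def)
  qed
  define \<Gamma> where "\<Gamma> z = Blinfun (inv (blinfun_apply (g' (inv g z))))" for z
  have bl: "bounded_linear (inv (blinfun_apply (g' w)))" if "w \<in> W" for w
    by (rule linear_conv_bounded_linear[THEN iffD1, OF inj_linear_imp_inv_linear[OF
          bounded_linear.linear[OF blinfun.bounded_linear_right] bij_is_inj[OF bijD[OF that]]]])
  have \<Gamma>: "blinfun_apply (\<Gamma> (g w)) = inv (blinfun_apply (g' w))" if "w \<in> W" for w
    unfolding \<Gamma>_def inj by (rule bounded_linear_Blinfun_apply[OF bl[OF that]])
  have right: "g' w (\<Gamma> (g w) v) = v" if "w \<in> W" for w v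
    using bijD[OF that] by (simp add: \<Gamma>[OF that] bij_def surj_f_inv_f)
  have left: "\<Gamma> (g w) (g' w v) = v" if "w \<in> W" for w v
    using bijD[OF that] by (simp add: \<Gamma>[OF that] bij_def)
  have norm\<Gamma>: "norm (\<Gamma> (g w) v) \<le> norm v / c" if "w \<in> W" for w v
    using low[OF that, of "\<Gamma> (g w) v"] c by (simp add: right[OF that] field_simps)
  have D: "(inv g has_derivative blinfun_apply (\<Gamma> z)) (at z)" if z: "z \<in> g ` W" for z
  proof -
    obtain w where w: "w \<in> W" "z = g w" using z by blast
    show ?thesis
      by (rule has_derivative_inverse_basic[where f = g and f' = "blinfun_apply (g' w)" and T = UNIV])
        (use w der left[OF w(1)] contI in \<open>auto simp: inj surj blinfun.bounded_linear_right 
           continuous_on_eq_continuous_at fun_eq_iff\<close>)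
  qed
  have "continuous_on (g ` W) \<Gamma>"
    unfolding continuous_on_def
  proof
    fix z assume z: "z \<in> g ` W"
    have "continuous_on (g ` W) (\<lambda>z. g' (inv g z))"
      by (rule continuous_on_compose2[OF g']) (auto simp: inj intro: continuous_on_subset[OF contI])
    then have "((\<lambda>x. g' (inv g x)) \<longlongrightarrow> g' (inv g z)) (at z within g ` W)"
      using z unfolding continuous_on_def by blast
    then have lim: "((\<lambda>x. norm (g' (inv g x) - g' (inv g z)) / (c * c)) \<longlongrightarrow> 0) (at z within g ` W)"
      by (intro tendsto_divide_zero tendsto_norm_zero LIM_zero)
    have bound: "norm (\<Gamma> x - \<Gamma> z) \<le> norm (g' (inv g x) - g' (inv g z)) / (c * c)" if x: "x \<in> g ` W" for x
    proof (rule norm_blinfun_bound)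
      fix v
      obtain w w' where w: "w \<in> W" "z = g w" and w': "w' \<in> W" "x = g w'" using z x by blast
      have "(\<Gamma> x - \<Gamma> z) v = \<Gamma> x ((g' w - g' w') (\<Gamma> z v))"
        using right[OF w(1)] left[OF w'(1)] w w' by (simp add: blinfun.bilinear_simps)
      also have "norm \<dots> \<le> norm ((g' w - g' w') (\<Gamma> z v)) / c"
        using norm\<Gamma>[OF w'(1)] w' by simp
      also have "\<dots> \<le> norm (g' w - g' w') * (norm v / c) / c"
      proof (rule divide_right_mono)
        have "norm ((g' w - g' w') (\<Gamma> z v)) \<le> norm (g' w - g' w') * norm (\<Gamma> z v)"
          by (rule norm_blinfun)
        also have "\<dots> \<le> norm (g' w - g' w') * (norm v / c)"
          using norm\<Gamma>[OF w(1), of v] w by (intro mult_left_mono) auto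
        finally show "norm ((g' w - g' w') (\<Gamma> z v)) \<le> norm (g' w - g' w') * (norm v / c)" .
      qed (use c in simp)
      finally show "norm ((\<Gamma> x - \<Gamma> z) v) \<le> norm (g' (inv g x) - g' (inv g z)) / (c * c) * norm v"
        using w w' by (simp add: inj norm_minus_commute)
    qed (use c in auto)
    have ev: "\<forall>\<^sub>F x in at z within g ` W.
        norm (\<Gamma> x - \<Gamma> z) \<le> norm (g' (inv g x) - g' (inv g z)) / (c * c)"
      unfolding eventually_at_filter using bound by (intro always_eventually) blast
    show "(\<Gamma> \<longlongrightarrow> \<Gamma> z) (at z within g ` W)"
      by (rule LIM_zero_cancel[OF Lim_null_comparison[OF ev lim]])
  qed
  then show ?thesis using D right inj by (intro exI[of _ \<Gamma>]) auto
qed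

text \<open>
  The chain rule product for the derivative of \<open>F\<^sup>k \<circ> T\<close>.  The recursion exposes the last factor, so
  that the images of a tangent vector under successive \<open>k\<close> form an orbit of the derivative cocycle.
\<close>

primrec iter_deriv ::
    "('a::real_normed_vector \<Rightarrow> 'a) \<Rightarrow> ('a \<Rightarrow> 'a \<Rightarrow>\<^sub>L 'a) \<Rightarrow> ('b::real_normed_vector \<Rightarrow> 'a) \<Rightarrow>
     ('b \<Rightarrow> 'b \<Rightarrow>\<^sub>L 'a) \<Rightarrow> nat \<Rightarrow> 'b \<Rightarrow> 'b \<Rightarrow>\<^sub>L 'a" where
  "iter_deriv F F' T T' 0 x = T' x"
| "iter_deriv F F' T T' (Suc k) x = F' ((F ^^ k) (T x)) o\<^sub>L iter_deriv F F' T T' k x"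

lemma has_derivative_iter_deriv:
  assumes F: "\<And>x. (F has_derivative blinfun_apply (F' x)) (at x)"
    and T: "(T has_derivative blinfun_apply (T' x)) (at x)"
  shows "((\<lambda>x. (F ^^ k) (T x)) has_derivative blinfun_apply (iter_deriv F F' T T' k x)) (at x)"
proof (induction k)
  case (Suc k)
  show ?case
    using diff_chain_at[OF Suc F, unfolded o_def] by (simp add: blinfun_compose.rep_eq o_def)
qed (use T in simp)

lemma continuous_on_iterates:
  fixes F :: "'a::topological_space \<Rightarrow> 'a"
  assumes F: "continuous_on UNIV F" and T: "continuous_on S T"
  shows "continuous_on S (\<lambda>x. (F ^^ k) (T x))"
proof (induction k)
  case (Suc k)
  show ?case using continuous_on_compose2[OF F Suc] by simp
qed (use T in simp)

lemma continuous_on_iter_deriv: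
  assumes F: "continuous_on UNIV F" and F': "continuous_on UNIV F'"
    and T: "continuous_on S T" and T': "continuous_on S T'"
  shows "continuous_on S (iter_deriv F F' T T' k)"
proof (induction k)
  case (Suc k)
  have "continuous_on S (\<lambda>x. F' ((F ^^ k) (T x)))"
    using continuous_on_compose2[OF F' continuous_on_iterates[OF F T]] by simp
  then show ?case using Suc by (auto intro!: continuous_intros)
qed (use T' in \<open>simp cong: continuous_on_cong\<close>)

lemma inj_iter_deriv:
  assumes "\<And>x. inj (blinfun_apply (F' x))" "inj (blinfun_apply (T' x))"
  shows "inj (blinfun_apply (iter_deriv F F' T T' k x))"
  using assms by (induction k) (auto simp: blinfun_compose.rep_eq intro: inj_compose)

lemma C1_on_open:
  assumes "open S"
  shows "C1_on S f \<longleftrightarrow> (\<exists>f'. continuous_on S f' \<and> (\<forall>x\<in>S. (f has_derivative blinfun_apply (f' x)) (at x)))"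
proof -
  have "(f has_derivative blinfun_apply (f' x)) (at x within S) \<longleftrightarrow> (f has_derivative blinfun_apply (f' x)) (at x)"
    if "x \<in> S" for f' x
    by (simp add: at_within_open[OF that assms])
  then show ?thesis unfolding C1_on_def by (simp cong: conj_cong)
qed

lemma C1_diffeo_on_derivative:
  fixes \<psi> :: "'a::real_normed_vector \<Rightarrow> 'b::real_normed_vector"
  assumes "C1_diffeo_on M \<psi>"
  shows "\<exists>\<psi>'. continuous_on M \<psi>' \<and>
    (\<forall>x\<in>M. (\<psi> has_derivative blinfun_apply (\<psi>' x)) (at x) \<and> inj (blinfun_apply (\<psi>' x)))"
proof -
  have op: "open M" "open (\<psi> ` M)" and inj: "inj_on \<psi> M"
    and 1: "C1_on M \<psi>" and 2: "C1_on (\<psi> ` M) (the_inv_into M \<psi>)"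
    using assms by (auto simp: C1_diffeo_on_def)
  obtain \<psi>' where \<psi>': "continuous_on M \<psi>'"
      "\<And>x. x \<in> M \<Longrightarrow> (\<psi> has_derivative blinfun_apply (\<psi>' x)) (at x)"
    using 1 unfolding C1_on_open[OF op(1)] by blast
  obtain \<theta> where \<theta>: "\<And>x. x \<in> \<psi> ` M \<Longrightarrow> (the_inv_into M \<psi> has_derivative blinfun_apply (\<theta> x)) (at x)"
    using 2 unfolding C1_on_open[OF op(2)] by blast
  have "inj (blinfun_apply (\<psi>' x))" if x: "x \<in> M" for x
  proof -
    have "((the_inv_into M \<psi>) \<circ> \<psi> has_derivative blinfun_apply (\<theta> (\<psi> x)) \<circ> blinfun_apply (\<psi>' x)) (at x)"
      using \<psi>'(2)[OF x] \<theta> x by (intro diff_chain_at) auto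
    then have "((\<lambda>x. x) has_derivative blinfun_apply (\<theta> (\<psi> x)) \<circ> blinfun_apply (\<psi>' x)) (at x)"
      using has_derivative_transform_within_open[OF _ op(1) x] inj by (fastforce simp: the_inv_into_f_f)
    then have "blinfun_apply (\<theta> (\<psi> x)) \<circ> blinfun_apply (\<psi>' x) = (\<lambda>x. x)"
      using has_derivative_unique has_derivative_ident by blast
    then show ?thesis by (metis inj_on_id2 inj_on_imageI2)
  qed
  then show ?thesis using \<psi>' by blast
qed

lemma C1_diffeo_on_inverse:
  assumes "C1_diffeo_on M \<psi>"
  shows "C1_diffeo_on (\<psi> ` M) (the_inv_into M \<psi>)"
proof -
  have op: "open M" "open (\<psi> ` M)" and inj: "inj_on \<psi> M"
    and 1: "C1_on M \<psi>" and 2: "C1_on (\<psi> ` M) (the_inv_into M \<psi>)"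
    using assms by (auto simp: C1_diffeo_on_def)
  have im: "the_inv_into M \<psi> ` \<psi> ` M = M" using inj by (auto simp: the_inv_into_f_f image_image)
  have inj': "inj_on (the_inv_into M \<psi>) (\<psi> ` M)" using inj by (rule inj_on_the_inv_into)
  have eq: "\<psi> x = the_inv_into (\<psi> ` M) (the_inv_into M \<psi>) x" if "x \<in> M" for x
    using the_inv_into_f_f[OF inj', of "\<psi> x"] that inj by (simp add: the_inv_into_f_f)
  have "C1_on M (the_inv_into (\<psi> ` M) (the_inv_into M \<psi>))"
    using 1 has_derivative_transform[of _ M "the_inv_into (\<psi> ` M) (the_inv_into M \<psi>)" \<psi>] eq
    unfolding C1_on_def by (metis (lifting))
  then show ?thesis using op inj' 2 im by (simp add: C1_diffeo_on_def)
qed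

section \<open>Disks in the vertical axis and graphs over them\<close>

text \<open>
  A derivative within \<open>M\<close> determines the velocity of \<open>f \<circ> \<gamma>\<close> for every curve \<open>\<gamma>\<close> in \<open>M\<close>, hence its
  values on the span of all velocities.
\<close>

lemma tangent_derivative_unique:
  assumes D: "(f has_derivative D) (at x within M)" and D': "(f has_derivative D') (at x within M)"
    and v: "v \<in> tangent_space M x"
  shows "D v = D' v"
proof -
  have vel: "(f \<circ> \<gamma> has_vector_derivative E w) (at 0 within {0..1})"
    if "(f has_derivative E) (at x within M)" "\<gamma> 0 = x" "\<forall>t\<in>{0..1}. \<gamma> t \<in> M"
      "(\<gamma> has_vector_derivative w) (at 0 within {0..1})" for E w and \<gamma> :: "real \<Rightarrow> _"
  proof -
    have "(f has_derivative E) (at (\<gamma> 0) within \<gamma> ` {0..1})"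
      using that by (auto intro: has_derivative_subset)
    then have "(f \<circ> \<gamma> has_derivative E \<circ> (\<lambda>t. t *\<^sub>R w)) (at 0 within {0..1})"
      using diff_chain_within that(4) unfolding has_vector_derivative_def by blast
    then show ?thesis
      using linear_cmul[OF has_derivative_linear[OF that(1)]] by (simp add: has_vector_derivative_def o_def)
  qed
  have "D w = D' w" if w: "\<gamma> 0 = x" "\<forall>t\<in>{0..1}. \<gamma> t \<in> M"
      "(\<gamma> has_vector_derivative w) (at 0 within {0..1})" for w \<gamma>
    using vector_derivative_unique_within_closed_interval[of 0 1 0 "f \<circ> \<gamma>" "D w" "D' w"]
      vel[OF D w] vel[OF D' w] by simp
  then show ?thesis
    using linear_eq_on_span[OF has_derivative_linear[OF D] has_derivative_linear[OF D'] _
        v[unfolded tangent_space_def]] by blast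
qed

lemma tangent_space_vertical:
  fixes N :: "('a::real_normed_vector \<times> 'b::real_normed_vector) set"
  assumes "N \<subseteq> {0} \<times> UNIV"
  shows "tangent_space N x \<subseteq> {0} \<times> UNIV"
  unfolding tangent_space_def
proof (rule span_minimal)
  show "subspace ({0} \<times> (UNIV :: 'b set))"
    by (auto intro!: subspace_Times simp: subspace_0)
  show "{v. \<exists>\<gamma>::real \<Rightarrow> _. \<gamma> 0 = x \<and> (\<forall>t\<in>{0..1}. \<gamma> t \<in> N) \<and>
           (\<gamma> has_vector_derivative v) (at 0 within {0..1})} \<subseteq> {0} \<times> UNIV"
  proof clarify
    fix a b and \<gamma> :: "real \<Rightarrow> 'a \<times> 'b"
    assume \<gamma>: "\<forall>t\<in>{0..1}. \<gamma> t \<in> N" "(\<gamma> has_vector_derivative (a, b)) (at 0 within {0..1})"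
    have "((\<lambda>t. fst (\<gamma> t)) has_vector_derivative a) (at 0 within {0..1})"
      using bounded_linear.has_vector_derivative[OF bounded_linear_fst \<gamma>(2)] by simp
    moreover have "((\<lambda>t. fst (\<gamma> t)) has_vector_derivative 0) (at 0 within {0..1})"
    proof (rule has_vector_derivative_transform)
      show "((\<lambda>t. 0::'a) has_vector_derivative 0) (at 0 within {0..1::real})" by simp
      show "fst (\<gamma> t) = 0" if "t \<in> {0..1}" for t
        using \<gamma>(1) assms that by (metis mem_Times_iff singletonD subsetD)
    qed simp
    ultimately have "a = 0"
      using vector_derivative_unique_within_closed_interval[of 0 1 0 "\<lambda>t. fst (\<gamma> t)" a 0] by simp
    then show "a \<in> {0} \<and> b \<in> UNIV" by simp
  qed
qed

text \<open>
  Injectivity on \<open>{0} \<times> UNIV\<close> suffices because all tangent spaces of \<open>N\<close> lie there; on them the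
  Frechet derivative chosen in the definition of an embedding agrees with \<open>h'\<close>.
\<close>

lemma C1_embedding_vertical:
  fixes h :: "'a::real_normed_vector \<times> 'b::real_normed_vector \<Rightarrow> 'c::real_normed_vector"
  assumes N: "N \<subseteq> {0} \<times> UNIV"
    and h': "continuous_on N h'" "\<And>x. x \<in> N \<Longrightarrow> (h has_derivative blinfun_apply (h' x)) (at x within N)"
    and k: "continuous_on (h ` N) k" "\<And>x. x \<in> N \<Longrightarrow> k (h x) = x"
    and inj: "\<And>x v w. x \<in> N \<Longrightarrow> h' x (0, v) = h' x (0, w) \<Longrightarrow> v = w"
  shows "C1_embedding N h"
  unfolding C1_embedding_def
proof (intro conjI ballI)
  show "C1_on N h" using h' unfolding C1_on_def by blast
  have "continuous_on N h"
    using h'(2) has_derivative_continuous continuous_on_eq_continuous_within by blast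
  then have "homeomorphism N (h ` N) h k"
    using k by (auto simp: homeomorphism_def image_image)
  then show "\<exists>g. homeomorphism N (h ` N) h g" by blast
  fix x assume x: "x \<in> N"
  have "(h has_derivative frechet_derivative h (at x within N)) (at x within N)"
    using h'(2)[OF x] frechet_derivative_works differentiable_def by blast
  then have eq: "frechet_derivative h (at x within N) v = h' x v" if "v \<in> tangent_space N x" for v
    using tangent_derivative_unique[OF _ h'(2)[OF x] that] by blast
  show "inj_on (frechet_derivative h (at x within N)) (tangent_space N x)"
  proof (rule inj_onI)
    fix v w assume v: "v \<in> tangent_space N x" and w: "w \<in> tangent_space N x"
      and "frechet_derivative h (at x within N) v = frechet_derivative h (at x within N) w"
    then have "h' x v = h' x w" by (simp add: eq)
    moreover have "v = (0, snd v)" "w = (0, snd w)"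
      using v w tangent_space_vertical[OF N, of x] by (auto simp: prod_eq_iff)
    ultimately show "v = w" using inj[OF x] by metis
  qed
qed

lemma C1_dist_id_vertical_le:
  fixes h :: "'a::real_normed_vector \<times> 'b::real_normed_vector \<Rightarrow> 'a \<times> 'b"
  assumes N: "N \<subseteq> {0} \<times> UNIV" "N \<noteq> {}"
    and h': "\<And>x. x \<in> N \<Longrightarrow> (h has_derivative h' x) (at x within N)"
    and d0: "0 \<le> d" and d: "\<And>x. x \<in> N \<Longrightarrow> norm (h x - x) \<le> d"
      "\<And>x v. x \<in> N \<Longrightarrow> norm (h' x (0, v) - (0, v)) \<le> d * norm v"
  shows "C1_dist N h id \<le> 2 * d"
proof -
  have "(SUP x\<in>N. norm (h x - id x)) \<le> d"
    using N(2) d(1) by (intro cSUP_least) auto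
  moreover have "(SUP x\<in>N. SUP v\<in>{v \<in> tangent_space N x. norm v \<le> 1}.
        norm (frechet_derivative h (at x within N) v - frechet_derivative id (at x within N) v)) \<le> d"
  proof (intro cSUP_least N(2))
    fix x assume x: "x \<in> N"
    have "0 \<in> tangent_space N x" unfolding tangent_space_def by (rule span_zero)
    then show "{v \<in> tangent_space N x. norm v \<le> 1} \<noteq> {}"
      by (metis (mono_tags, lifting) empty_iff mem_Collect_eq norm_zero zero_le_one)
    fix v assume "v \<in> {v \<in> tangent_space N x. norm v \<le> 1}"
    then have v: "v \<in> tangent_space N x" "norm v \<le> 1" by auto
    have v0: "v = (0, snd v)" using v(1) tangent_space_vertical[OF N(1), of x] by (auto simp: prod_eq_iff)
    have "(h has_derivative frechet_derivative h (at x within N)) (at x within N)"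
      using h'[OF x] frechet_derivative_works differentiable_def by blast
    then have "frechet_derivative h (at x within N) v = h' x v"
      using tangent_derivative_unique[OF _ h'[OF x] v(1)] by blast
    moreover have "frechet_derivative id (at x within N) v = v"
      using tangent_derivative_unique[OF
          frechet_derivative_works[THEN iffD1, OF differentiableI[OF has_derivative_id]]
          has_derivative_id v(1)] by simp
    moreover have "norm (h' x v - v) \<le> d * norm (snd v)"
      using d(2)[OF x, of "snd v"] v0 by metis
    moreover have "d * norm (snd v) \<le> d"
      using mult_left_mono[OF order.trans[OF norm_component_le(2) v(2)] d0] by simp
    ultimately show "norm (frechet_derivative h (at x within N) v - frechet_derivative id (at x within N) v) \<le> d"
      by simp
  qed
  ultimately show ?thesis unfolding C1_dist_def by simp
qed

lemma C1_disk_vertical: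
  assumes "0 < \<rho>"
  shows "C1_disk CARD('u) ({0} \<times> cball 0 \<rho> :: (('s::finite, 'u::finite) phase) set)"
  unfolding C1_disk_def
proof (intro exI conjI)
  let ?L = "{0} \<times> UNIV :: (('s, 'u) phase) set"
  show "subspace ?L" by (auto intro!: subspace_Times simp: subspace_0)
  show "dim ?L = CARD('u)" by (subst dim_Times) (auto simp: subspace_0)
  have L1: "?L \<inter> cball 0 1 = {0} \<times> cball 0 1"
    by (auto simp: norm_Pair)
  show "C1_embedding (?L \<inter> cball 0 1) (\<lambda>x. \<rho> *\<^sub>R x)"
  proof (rule C1_embedding_vertical)
    show "continuous_on (?L \<inter> cball 0 1) (\<lambda>x. \<rho> *\<^sub>R id_blinfun)" by simp
    show "((\<lambda>x. \<rho> *\<^sub>R x) has_derivative blinfun_apply (\<rho> *\<^sub>R id_blinfun)) (at x within ?L \<inter> cball 0 1)" for x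
    proof -
      have "blinfun_apply (\<rho> *\<^sub>R id_blinfun) = (\<lambda>x :: ('s, 'u) phase. \<rho> *\<^sub>R x)"
        by (simp add: fun_eq_iff blinfun.scaleR_left)
      then show ?thesis
        by (simp add: bounded_linear_imp_has_derivative bounded_linear_scaleR_right)
    qed
    show "continuous_on ((\<lambda>x. \<rho> *\<^sub>R x) ` (?L \<inter> cball 0 1)) (\<lambda>x. (1 / \<rho>) *\<^sub>R x)"
      by (intro continuous_intros)
    show "(1 / \<rho>) *\<^sub>R (\<rho> *\<^sub>R x) = x" for x :: "('s, 'u) phase"
      using assms by simp
    show "v = w" if "blinfun_apply (\<rho> *\<^sub>R id_blinfun) (0::real^'s, v) = (\<rho> *\<^sub>R id_blinfun) (0, w)" for v w :: "real^'u"
    proof -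
      have "\<rho> *\<^sub>R v = \<rho> *\<^sub>R w" using that unfolding blinfun.scaleR_left by simp
      then show "v = w" using assms by simp
    qed
  qed blast
  have P: "{0::real^'s} \<times> X = Pair 0 ` X" for X :: "(real^'u) set" by auto
  have "cball 0 \<rho> = (\<lambda>z. \<rho> *\<^sub>R z) ` cball (0::real^'u) 1"
    using assms by (simp add: cball_scale)
  then show "{0} \<times> cball 0 \<rho> = (\<lambda>x. \<rho> *\<^sub>R x) ` (?L \<inter> cball 0 1)"
    unfolding L1 unfolding P by (simp add: image_image)
qed

section \<open>Dynamics near a fixed point with straightened invariant manifolds\<close>

definition bidisk :: "real \<Rightarrow> ('a::real_normed_vector \<times> 'b::real_normed_vector) set" where
  "bidisk r = cball 0 r \<times> cball 0 r"

lemma mem_bidisk: "x \<in> bidisk r \<longleftrightarrow> norm (fst x) \<le> r \<and> norm (snd x) \<le> r"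
  by (auto simp: bidisk_def mem_Times_iff)

lemma compact_bidisk: "compact (bidisk r :: ('a::euclidean_space \<times> 'b::euclidean_space) set)"
  by (simp add: bidisk_def compact_Times)

text \<open>
  Despite the name, \<open>e\<close> has the dimension of the unstable direction: for \<open>c > 0\<close> it parametrizes a Lipschitz graph
  \<open>y = \<eta>(z)\<close> with constant one, but not necessarily by \<open>z\<close>.  This freedom avoids a reparametrization
  after each iteration.
\<close>

definition steep_curve :: "real \<Rightarrow> ('b::real_normed_vector \<Rightarrow> 'a::real_normed_vector \<times> 'b) \<Rightarrow> bool" where
  "steep_curve c e \<longleftrightarrow> (\<forall>w w'. norm (fst (e w - e w')) \<le> norm (snd (e w - e w')) \<and>
     c * norm (w - w') \<le> norm (snd (e w - e w')))"

text \<open>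
  Smoothness is asked for only near the parameter \<open>0\<close>; the global continuation of a disk can have a corner
  at the boundary of the disk.
\<close>

definition steep_C1_curve ::
    "real \<Rightarrow> real \<Rightarrow> real \<Rightarrow> ('b::real_normed_vector \<Rightarrow> 'a::real_normed_vector \<times> 'b) \<Rightarrow> bool" where
  "steep_C1_curve s c \<delta> e \<longleftrightarrow> steep_curve c e \<and> continuous_on UNIV e \<and> C1_on (ball 0 \<delta>) e \<and>
     norm (fst (e 0)) \<le> s \<and> snd (e 0) = 0"

definition contains_close_disk ::
    "real \<Rightarrow> real \<Rightarrow> ('a::real_normed_vector \<times> 'b::real_normed_vector) set \<Rightarrow> bool" where
  "contains_close_disk \<rho> \<epsilon> X \<longleftrightarrow> (\<exists>h. C1_embedding ({0} \<times> cball 0 \<rho>) h \<and>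
     h ` ({0} \<times> cball 0 \<rho>) \<subseteq> X \<and> C1_dist ({0} \<times> cball 0 \<rho>) h id < \<epsilon>)"

lemma contains_close_disk_mono: "contains_close_disk \<rho> \<epsilon> X \<Longrightarrow> X \<subseteq> Y \<Longrightarrow> contains_close_disk \<rho> \<epsilon> Y"
  unfolding contains_close_disk_def by blast

text \<open>
  The situation near the fixed point after straightening of the invariant manifolds: in the box
  \<open>bidisk r\<close> they are the two axes.  \<open>F\<close> carries the dynamics; its extension \<open>f\<close> is close to the linear
  part on the whole space and serves to iterate unbounded graphs.  The constant \<open>\<kappa>\<close> measures how far
  the derivatives in the box are from the linear part; the factor \<open>8\<close> leaves room for the slope
  recursions below, which lose up to \<open>3 \<kappa>\<close> of the gap \<open>b - a\<close> and along the stable axis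
  have to lead to slopes below \<open>1/2\<close>.
\<close>

locale straightened_saddle =
  fixes F f :: "'a::euclidean_space \<times> 'b::euclidean_space \<Rightarrow> 'a \<times> 'b"
    and F' f' :: "'a \<times> 'b \<Rightarrow> ('a \<times> 'b) \<Rightarrow>\<^sub>L ('a \<times> 'b)"
    and B :: "'a \<Rightarrow> 'a" and C :: "'b \<Rightarrow> 'b"
    and a b L r \<kappa> :: real
    and V :: "'a \<times> 'b \<Rightarrow> real"
  assumes F_deriv: "\<And>x. (F has_derivative blinfun_apply (F' x)) (at x)"
    and F'_cont: "continuous_on UNIV F'"
    and F'_inj: "\<And>x. inj (blinfun_apply (F' x))"
    and f_deriv: "\<And>x. (f has_derivative blinfun_apply (f' x)) (at x)"
    and f'_cont: "continuous_on UNIV f'"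
    and a_nonneg: "0 \<le> a"
    and B_lin: "linear B" and B_le: "\<And>y. norm (B y) \<le> a * norm y"
    and C_lin: "linear C" and C_ge: "\<And>z. b * norm z \<le> norm (C z)"
    and f_lip: "L-lipschitz_on UNIV (\<lambda>x. f x - map_prod B C x)" and gap: "4 * L < b - a"
    and \<kappa>: "0 < \<kappa>" "a + \<kappa> < 1" "8 * \<kappa> \<le> b - a"
    and r_pos: "0 < r"
    and F_eq_f: "\<And>x. x \<in> bidisk r \<Longrightarrow> F x = f x"
    and F'_close: "\<And>x v. x \<in> bidisk r \<Longrightarrow> norm (F' x v - map_prod B C v) \<le> \<kappa> * norm v"
    and f'_close: "\<And>x v. x \<in> bidisk r \<Longrightarrow> norm (f' x v - map_prod B C v) \<le> \<kappa> * norm v"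
    and unstable_axis: "\<And>z. norm z \<le> r \<Longrightarrow> fst (f (0, z)) = 0"
    and stable_axis: "\<And>y. norm y \<le> r \<Longrightarrow> snd (f (y, 0)) = 0"
    and V_cont: "continuous_on (bidisk r) V"
    and V_nonneg: "\<And>x. x \<in> bidisk r \<Longrightarrow> 0 \<le> V x"
    and V_zero: "\<And>x. x \<in> bidisk r \<Longrightarrow> V x = 0 \<longleftrightarrow> snd x = 0"
    and V_mono: "\<And>x. x \<in> bidisk r \<Longrightarrow> F x \<in> bidisk r \<Longrightarrow> V x \<le> V (F x)"
begin

lemma L_nonneg: "0 \<le> L"
  using f_lip by (rule lipschitz_on_nonneg)

lemma rate_pos: "0 < b - 2 * L"
  using gap a_nonneg L_nonneg by linarith

lemma f_cont: "continuous_on UNIV f"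
  using f_deriv by (meson continuous_at_imp_continuous_on has_derivative_continuous)

lemma F_cont: "continuous_on UNIV F"
  using F_deriv by (meson continuous_at_imp_continuous_on has_derivative_continuous)

text \<open>
  In the cone \<open>|y| \<le> |z|\<close> one has \<open>|x| \<le> 2 |z|\<close>, so the nonlinear part changes either component by at
  most \<open>2 L |z|\<close>; the gap condition is \<open>a + 2 L < b - 2 L\<close>.
\<close>

lemma secant_step:
  assumes x: "norm (fst (x - x')) \<le> norm (snd (x - x'))"
  shows "norm (fst (f x - f x')) \<le> norm (snd (f x - f x'))"
    and "(b - 2 * L) * norm (snd (x - x')) \<le> norm (snd (f x - f x'))"
proof -
  define D where "D = x - x'"
  define E where "E = (f x - map_prod B C x) - (f x' - map_prod B C x')"
  have fD: "f x - f x' = map_prod B C D + E"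
    using linear_diff[OF B_lin] linear_diff[OF C_lin]
    by (simp add: D_def E_def prod_eq_iff map_prod_def case_prod_beta)
  have "norm E \<le> L * norm D"
    using lipschitz_onD[OF f_lip, of x x'] by (simp add: E_def D_def dist_norm)
  also have "\<dots> \<le> L * (2 * norm (snd D))"
    using norm_le_sum_components[of D] x L_nonneg by (intro mult_left_mono) (auto simp: D_def)
  finally have E: "norm E \<le> 2 * L * norm (snd D)" by simp
  have 1: "norm (fst (f x - f x')) \<le> a * norm (snd D) + 2 * L * norm (snd D)"
  proof -
    have "norm (fst (f x - f x')) \<le> norm (B (fst D)) + norm (fst E)"
      unfolding fD by (simp add: norm_triangle_ineq)
    also have "norm (B (fst D)) \<le> a * norm (snd D)"
      using B_le[of "fst D"] mult_left_mono[OF x a_nonneg] by (simp add: D_def)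
    finally show ?thesis using E norm_component_le(1)[of E] by linarith
  qed
  have 2: "b * norm (snd D) - 2 * L * norm (snd D) \<le> norm (snd (f x - f x'))"
  proof -
    have "norm (C (snd D)) \<le> norm (snd (f x - f x')) + norm (snd E)"
      unfolding fD using norm_triangle_ineq4[of "C (snd D) + snd E" "snd E"] by simp
    then show ?thesis using E norm_component_le(2)[of E] C_ge[of "snd D"] by linarith
  qed
  show "(b - 2 * L) * norm (snd (x - x')) \<le> norm (snd (f x - f x'))"
    using 2 by (simp add: D_def algebra_simps)
  have "(a + 2 * L) * norm (snd D) \<le> (b - 2 * L) * norm (snd D)"
    using gap by (intro mult_right_mono) auto
  then show "norm (fst (f x - f x')) \<le> norm (snd (f x - f x'))"
    using 1 2 by (simp add: algebra_simps)
qed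

lemma secant_iterate:
  assumes "norm (fst (x - x')) \<le> norm (snd (x - x'))"
  shows "norm (fst ((f ^^ k) x - (f ^^ k) x')) \<le> norm (snd ((f ^^ k) x - (f ^^ k) x')) \<and>
    (b - 2 * L) ^ k * norm (snd (x - x')) \<le> norm (snd ((f ^^ k) x - (f ^^ k) x'))"
proof (induction k)
  case (Suc k)
  let ?d = "(f ^^ k) x - (f ^^ k) x'"
  have "(b - 2 * L) ^ Suc k * norm (snd (x - x')) \<le> (b - 2 * L) * norm (snd ?d)"
    using mult_left_mono[OF conjunct2[OF Suc] less_imp_le[OF rate_pos]] by (simp add: mult.assoc)
  then show ?case using secant_step[OF conjunct1[OF Suc]] by simp
qed (use assms in simp)

text \<open>
  The \<open>y\<close>-component of \<open>f\<close> vanishes on the \<open>z\<close>-axis; the estimate is the mean value theorem in the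
  \<open>y\<close>-direction.
\<close>

lemma fst_contract:
  assumes x: "x \<in> bidisk r"
  shows "norm (fst (f x)) \<le> (a + \<kappa>) * norm (fst x)"
proof -
  let ?g = "\<lambda>y. fst (f (y, snd x))"
  let ?g' = "\<lambda>y v. fst (f' (y, snd x) (v, 0))"
  have "norm (?g (fst x) - ?g 0) \<le> (a + \<kappa>) * norm (fst x - 0)"
  proof (rule differentiable_bound)
    show "convex (cball (0::'a) r)" by (rule convex_cball)
    show "fst x \<in> cball 0 r" "0 \<in> cball (0::'a) r" using x r_pos by (auto simp: mem_bidisk)
    fix y :: 'a assume y: "y \<in> cball 0 r"
    have "((\<lambda>y. (y, snd x)) has_derivative (\<lambda>v. (v, 0))) (at y within cball 0 r)"
      by (auto intro!: derivative_eq_intros)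
    from diff_chain_within[OF this has_derivative_at_withinI[OF f_deriv]]
    have "((\<lambda>y. f (y, snd x)) has_derivative (\<lambda>v. f' (y, snd x) (v, 0))) (at y within cball 0 r)"
      by (simp add: o_def)
    then show "(?g has_derivative ?g' y) (at y within cball 0 r)"
      by (rule bounded_linear.has_derivative[OF bounded_linear_fst])
    have yx: "(y, snd x) \<in> bidisk r" using y x by (simp add: mem_bidisk)
    show "onorm (?g' y) \<le> a + \<kappa>"
    proof (rule onorm_bound)
      fix v
      have "norm (?g' y v) \<le> norm (B v) + norm (?g' y v - B v)"
        using norm_triangle_ineq[of "B v" "?g' y v - B v"] by simp
      also have "norm (?g' y v - B v) \<le> \<kappa> * norm v"
        using order.trans[OF norm_component_le(1) f'_close[OF yx, of "(v, 0)"]]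
        by (simp add: norm_Pair)
      finally show "norm (?g' y v) \<le> (a + \<kappa>) * norm v"
        using B_le[of v] by (simp add: algebra_simps)
    qed (use a_nonneg \<kappa>(1) in simp)
  qed
  then show ?thesis using unstable_axis[of "snd x"] x by (simp add: mem_bidisk)
qed

lemma fst_decay:
  assumes "\<And>j. j < k \<Longrightarrow> (f ^^ j) x \<in> bidisk r"
  shows "norm (fst ((f ^^ k) x)) \<le> (a + \<kappa>) ^ k * norm (fst x)"
  using assms
proof (induction k)
  case (Suc k)
  have "norm (fst ((f ^^ Suc k) x)) \<le> (a + \<kappa>) * norm (fst ((f ^^ k) x))"
    using fst_contract[OF Suc.prems[of k]] by simp
  also have "\<dots> \<le> (a + \<kappa>) * ((a + \<kappa>) ^ k * norm (fst x))"
    using Suc a_nonneg \<kappa>(1) by (intro mult_left_mono) auto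
  finally show ?case by (simp add: mult.assoc)
qed simp

lemma power_rate_le_1: "(a + \<kappa>) ^ k \<le> 1"
  using \<kappa> a_nonneg by (intro power_le_one) auto

lemma stable_axis_orbit:
  assumes "snd x = 0" "norm (fst x) \<le> s" "s \<le> r"
  shows "snd ((f ^^ k) x) = 0 \<and> norm (fst ((f ^^ k) x)) \<le> (a + \<kappa>) ^ k * s"
proof (induction k)
  case (Suc k)
  let ?y = "(f ^^ k) x"
  have "norm (fst ?y) \<le> 1 * s"
    using Suc assms power_rate_le_1[of k] norm_ge_zero[of "fst x"]
    by (intro order.trans[OF conjunct2[OF Suc] mult_right_mono]) linarith+
  then have y: "?y \<in> bidisk r" "?y = (fst ?y, 0)"
    using Suc assms r_pos by (auto simp: mem_bidisk prod_eq_iff)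
  have "norm (fst (f ?y)) \<le> (a + \<kappa>) * ((a + \<kappa>) ^ k * s)"
    using fst_contract[OF y(1)] conjunct2[OF Suc] a_nonneg \<kappa>(1)
    by (intro order.trans[OF fst_contract[OF y(1)] mult_left_mono]) auto
  moreover have "snd (f ?y) = 0"
    using stable_axis[of "fst ?y"] y by (metis mem_bidisk)
  ultimately show ?case by (simp add: mult.assoc)
qed (use assms in simp)

text \<open>
  The block \<open>\<partial>\<^sub>z f\<^sub>y\<close> is zero on the invariant \<open>z\<close>-axis and uniformly continuous on the box.
\<close>

lemma mixed_derivative_small:
  assumes "0 < \<omega>"
  shows "\<exists>s>0. \<forall>x\<in>bidisk r. norm (fst x) \<le> s \<longrightarrow> norm (snd x) < r \<longrightarrow>
           (\<forall>v. norm (fst (f' x (0, v))) \<le> \<omega> * norm v)"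
proof -
  have "uniformly_continuous_on (bidisk r) f'"
    by (rule compact_uniformly_continuous[OF continuous_on_subset[OF f'_cont] compact_bidisk]) simp
  then obtain d where d: "0 < d" "\<And>x x'. x \<in> bidisk r \<Longrightarrow> x' \<in> bidisk r \<Longrightarrow> dist x' x < d \<Longrightarrow> dist (f' x') (f' x) < \<omega>"
    using \<open>0 < \<omega>\<close> unfolding uniformly_continuous_on_def by meson
  have "norm (fst (f' x (0, v))) \<le> \<omega> * norm v"
    if x: "x \<in> bidisk r" "norm (fst x) \<le> d / 2" "norm (snd x) < r" for x v
  proof -
    let ?x0 = "(0::'a, snd x)"
    have "x - ?x0 = (fst x, 0)" by (simp add: prod_eq_iff)
    then have "dist x ?x0 < d" using x(2) d(1) by (simp add: dist_norm norm_Pair)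
    moreover have "?x0 \<in> bidisk r" using x r_pos by (simp add: mem_bidisk)
    ultimately have close: "norm (f' x - f' ?x0) \<le> \<omega>"
      using less_imp_le[OF d(2)[of ?x0 x]] x(1) by (simp only: dist_norm)
    have "fst (f' ?x0 (0, v)) = 0"
    proof (rule has_derivative_constant_direction[where S = "{x. norm (snd x) < r}" and h = fst
          and l = "\<lambda>v. (0, v)", OF f_deriv])
      show "open {x :: 'a \<times> 'b. norm (snd x) < r}"
        by (intro open_Collect_less continuous_intros)
      show "bounded_linear (\<lambda>v. (0::'a, v::'b))"
        by (intro bounded_linear_Pair bounded_linear_zero bounded_linear_ident)
    qed (use x(3) in \<open>auto simp: bounded_linear_fst unstable_axis\<close>)
    then have "fst (f' x (0, v)) = fst ((f' x - f' ?x0) (0, v))"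
      by (simp add: blinfun.diff_left)
    also have "norm \<dots> \<le> norm (f' x - f' ?x0) * norm (0::'a, v)"
      using norm_component_le(1) norm_blinfun order.trans by blast
    also have "\<dots> \<le> \<omega> * norm v" using close by (simp add: norm_Pair mult_right_mono)
    finally show ?thesis .
  qed
  then show ?thesis using d(1) by (intro exI[of _ "d / 2"]) auto
qed

lemma cone_step:
  assumes x: "x \<in> bidisk r" and \<omega>: "\<omega> \<le> \<kappa>" "\<And>v. norm (fst (f' x (0, v))) \<le> \<omega> * norm v"
    and \<sigma>: "norm (fst v) \<le> \<sigma> * norm (snd v)" "0 \<le> \<sigma>" "\<sigma> \<le> 1"
  shows "norm (fst (f' x v)) \<le> ((a + \<kappa>) * \<sigma> + \<omega>) * norm (snd v)"
    and "(b - 2 * \<kappa>) * norm (snd v) \<le> norm (snd (f' x v))"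
proof -
  have v: "v = (fst v, 0) + (0, snd v)" by (simp add: prod_eq_iff)
  have "norm (fst (f' x v)) \<le> norm (fst (f' x (fst v, 0))) + norm (fst (f' x (0, snd v)))"
    by (subst v, simp only: blinfun.add_right fst_add norm_triangle_ineq)
  also have "norm (fst (f' x (fst v, 0))) \<le> (a + \<kappa>) * norm (fst v)"
  proof -
    have "norm (fst (f' x (fst v, 0)) - B (fst v)) \<le> \<kappa> * norm (fst v)"
      using order.trans[OF norm_component_le(1) f'_close[OF x, of "(fst v, 0)"]]
      by (simp add: norm_Pair)
    then show ?thesis
      using norm_triangle_sub[of "fst (f' x (fst v, 0))" "B (fst v)"] B_le[of "fst v"]
      by (simp add: algebra_simps)
  qed
  also have "\<dots> \<le> (a + \<kappa>) * (\<sigma> * norm (snd v))"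
    using \<sigma> a_nonneg \<kappa>(1) by (intro mult_left_mono) auto
  finally show "norm (fst (f' x v)) \<le> ((a + \<kappa>) * \<sigma> + \<omega>) * norm (snd v)"
    using \<omega>(2)[of "snd v"] by (simp add: algebra_simps)
  have "\<sigma> * norm (snd v) \<le> 1 * norm (snd v)" using \<sigma> by (intro mult_right_mono) auto
  then have "norm v \<le> 2 * norm (snd v)" using norm_le_sum_components[of v] \<sigma>(1) by simp
  then have "\<kappa> * norm v \<le> \<kappa> * (2 * norm (snd v))" using \<kappa>(1) by (intro mult_left_mono) auto
  then have "norm (snd (f' x v) - C (snd v)) \<le> 2 * \<kappa> * norm (snd v)"
    using order.trans[OF norm_component_le(2) f'_close[OF x, of v]] by simp
  then have "norm (C (snd v)) \<le> norm (snd (f' x v)) + 2 * \<kappa> * norm (snd v)"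
    using norm_triangle_sub[of "C (snd v)" "snd (f' x v)"] by (simp add: norm_minus_commute)
  then show "(b - 2 * \<kappa>) * norm (snd v) \<le> norm (snd (f' x v))"
    using C_ge[of "snd v"] by (simp add: algebra_simps)
qed

lemma mixed_derivative_le:
  assumes "x \<in> bidisk r"
  shows "norm (fst (f' x (0, v))) \<le> \<kappa> * norm v"
proof -
  have "norm (fst (f' x (0, v) - map_prod B C (0, v))) \<le> \<kappa> * norm (0::'a, v)"
    by (rule order.trans[OF norm_component_le(1) f'_close[OF assms]])
  then show ?thesis using linear_0[OF B_lin] by (simp add: norm_Pair)
qed

text \<open>
  Points staying in the box approach the \<open>z\<close>-axis uniformly fast, so after \<open>J\<close> steps the inhomogeneous
  term of the slope recursion is at most \<open>\<omega>\<close>; after \<open>i\<close> further steps the slope is at most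
  \<open>q\<^sup>i + \<tau>\<close>.  The cone field \<open>|y| \<le> |z|\<close> carries the vectors through the first
  \<open>J\<close> steps.
\<close>

lemma cone_slopes_vanish:
  assumes "0 < \<epsilon>"
  shows "\<exists>k0. \<forall>k\<ge>k0. \<forall>x (v :: nat \<Rightarrow> 'a \<times> 'b).
     (\<forall>j\<le>k. (f ^^ j) x \<in> bidisk r \<and> norm (snd ((f ^^ j) x)) < r) \<longrightarrow>
     norm (fst (v 0)) \<le> norm (snd (v 0)) \<longrightarrow> (\<forall>j<k. v (Suc j) = f' ((f ^^ j) x) (v j)) \<longrightarrow>
     norm (fst (v k)) \<le> \<epsilon> * norm (snd (v k))"
proof -
  define q where "q = (a + \<kappa>) / (b - 2 * \<kappa>)"
  have den: "0 < b - 2 * \<kappa>" "0 < b - a - 3 * \<kappa>" using \<kappa> a_nonneg by linarith+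
  have q: "0 \<le> q" "q < 1" using den a_nonneg \<kappa>(1) by (auto simp: q_def field_simps)
  have q_mult: "(b - 2 * \<kappa>) * q = a + \<kappa>" using den by (simp add: q_def)
  \<comment> \<open>\<open>\<tau>\<close> is the fixed point of the slope recursion \<open>\<sigma> \<mapsto> ((a + \<kappa>) \<sigma> + \<omega>) / (b - 2 \<kappa>)\<close>.\<close>
  define \<tau> where "\<tau> = \<epsilon> / 2"
  define \<omega> where "\<omega> = (b - a - 3 * \<kappa>) * \<tau>"
  have \<tau>: "0 < \<tau>" "\<tau> \<le> \<epsilon> / 2" using assms by (simp_all add: \<tau>_def)
  have \<omega>: "0 < \<omega>" using den \<tau> by (simp add: \<omega>_def)
  define \<omega>' where "\<omega>' = min \<omega> \<kappa>"
  have \<omega>': "0 < \<omega>'" "\<omega>' \<le> \<omega>" "\<omega>' \<le> \<kappa>" using \<omega> \<kappa>(1) by (auto simp: \<omega>'_def)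
  obtain s where s: "0 < s" "\<And>x v. x \<in> bidisk r \<Longrightarrow> norm (fst x) \<le> s \<Longrightarrow> norm (snd x) < r \<Longrightarrow>
      norm (fst (f' x (0, v))) \<le> \<omega>' * norm v"
    using mixed_derivative_small[OF \<omega>'(1)] by blast
  have "(\<lambda>n. (a + \<kappa>) ^ n * r) \<longlonglongrightarrow> 0 * r"
    using \<kappa> a_nonneg by (intro tendsto_intros LIMSEQ_power_zero) auto
  then obtain J where J: "\<And>n. n \<ge> J \<Longrightarrow> (a + \<kappa>) ^ n * r < s"
    using s(1) order_tendstoD(2)[of "\<lambda>n. (a + \<kappa>) ^ n * r" 0 sequentially s]
    by (auto simp: eventually_sequentially)
  have "(\<lambda>n. q ^ n) \<longlonglongrightarrow> 0" using q by (intro LIMSEQ_power_zero) auto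
  then obtain I where I: "\<And>n. n \<ge> I \<Longrightarrow> q ^ n < \<epsilon> / 2"
    using assms order_tendstoD(2)[of "\<lambda>n. q ^ n" 0 sequentially "\<epsilon> / 2"]
    by (auto simp: eventually_sequentially)
  show ?thesis
  proof (intro exI[of _ "J + I"] allI impI)
    fix k x and v :: "nat \<Rightarrow> 'a \<times> 'b"
    assume k: "J + I \<le> k"
      and orb: "\<forall>j\<le>k. (f ^^ j) x \<in> bidisk r \<and> norm (snd ((f ^^ j) x)) < r"
      and v0: "norm (fst (v 0)) \<le> norm (snd (v 0))"
      and v: "\<forall>j<k. v (Suc j) = f' ((f ^^ j) x) (v j)"
    have cone: "norm (fst (v j)) \<le> norm (snd (v j))" if "j \<le> k" for j
      using that
    proof (induction j)
      case (Suc j)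
      then have "(f ^^ j) x \<in> bidisk r" "v (Suc j) = f' ((f ^^ j) x) (v j)" using orb v by auto
      then have "norm (fst (v (Suc j))) \<le> ((a + \<kappa>) * 1 + \<kappa>) * norm (snd (v j))"
          and "(b - 2 * \<kappa>) * norm (snd (v j)) \<le> norm (snd (v (Suc j)))"
        using cone_step[of "(f ^^ j) x" \<kappa> "v j" 1] mixed_derivative_le Suc by auto
      moreover have "((a + \<kappa>) * 1 + \<kappa>) * norm (snd (v j)) \<le> (b - 2 * \<kappa>) * norm (snd (v j))"
        using \<kappa> by (intro mult_right_mono) auto
      ultimately show ?case by linarith
    qed (use v0 in simp)
    have slope: "norm (fst (v (J + i))) \<le> (q ^ i + \<tau>) * norm (snd (v (J + i)))" if "J + i \<le> k" for i
      using that
    proof (induction i)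
      case 0
      have "norm (fst (v J)) \<le> 1 * norm (snd (v J))" using cone 0 by simp
      also have "\<dots> \<le> (1 + \<tau>) * norm (snd (v J))" using \<tau> by (intro mult_right_mono) auto
      finally show ?case by simp
    next
      case (Suc i)
      let ?x = "(f ^^ (J + i)) x" and ?v = "v (J + i)"
      let ?\<sigma> = "min 1 (q ^ i + \<tau>)"
      have x: "?x \<in> bidisk r" "norm (snd ?x) < r" using orb Suc.prems by auto
      have "norm (fst x) \<le> r" using orb by (auto simp: mem_bidisk dest: spec[of _ 0])
      then have "norm (fst ?x) \<le> (a + \<kappa>) ^ (J + i) * r"
        using fst_decay[of "J + i" x] orb Suc.prems a_nonneg \<kappa>(1)
        by (intro order.trans[OF fst_decay mult_left_mono]) auto
      then have "norm (fst ?x) \<le> s" using J[of "J + i"] by simp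
      then have om: "norm (fst (f' ?x (0, v))) \<le> \<omega>' * norm v" for v using s(2) x by blast
      have "norm (fst ?v) \<le> (q ^ i + \<tau>) * norm (snd ?v)" using Suc by simp
      then have "norm (fst ?v) \<le> ?\<sigma> * norm (snd ?v)"
        using cone[of "J + i"] Suc.prems by (simp add: min_def)
      moreover have "0 \<le> ?\<sigma>" using q \<tau> by simp
      ultimately have 1: "norm (fst (f' ?x ?v)) \<le> ((a + \<kappa>) * ?\<sigma> + \<omega>') * norm (snd ?v)"
        and 2: "(b - 2 * \<kappa>) * norm (snd ?v) \<le> norm (snd (f' ?x ?v))"
        using cone_step[OF x(1) \<omega>'(3) om, of ?v ?\<sigma>] by auto
      have "(a + \<kappa>) * ?\<sigma> + \<omega>' \<le> (a + \<kappa>) * (q ^ i + \<tau>) + \<omega>"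
        using a_nonneg \<kappa>(1) \<omega>' by (intro add_mono mult_left_mono) auto
      also have "\<dots> = (a + \<kappa>) * q ^ i + (b - 2 * \<kappa>) * \<tau>"
        by (simp add: \<omega>_def algebra_simps)
      also have "\<dots> = (b - 2 * \<kappa>) * (q ^ Suc i + \<tau>)"
        unfolding q_mult[symmetric] by (simp add: distrib_left mult.assoc)
      finally have "norm (fst (f' ?x ?v)) \<le> (b - 2 * \<kappa>) * (q ^ Suc i + \<tau>) * norm (snd ?v)"
        by (intro order.trans[OF 1 mult_right_mono]) auto
      also have "\<dots> = (q ^ Suc i + \<tau>) * ((b - 2 * \<kappa>) * norm (snd ?v))" by simp
      also have "\<dots> \<le> (q ^ Suc i + \<tau>) * norm (snd (f' ?x ?v))"
        using 2 q \<tau> by (intro mult_left_mono) auto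
      finally show ?case using v Suc.prems by simp
    qed
    define i where "i = k - J"
    have i: "J + i = k" "I \<le> i" using k by (auto simp: i_def)
    have "norm (fst (v k)) \<le> (q ^ i + \<tau>) * norm (snd (v k))" using slope[of i] i by simp
    also have "\<dots> \<le> \<epsilon> * norm (snd (v k))"
      using I[OF i(2)] \<tau> by (intro mult_right_mono) auto
    finally show "norm (fst (v k)) \<le> \<epsilon> * norm (snd (v k))" .
  qed
qed

text \<open>
  The only place where instability enters.  The final height bound \<open>\<rho>\<close> depends on the curve only
  through \<open>c\<close> and \<open>\<delta>\<close>, and not on the number of iterations.  Comparison with the orbit of \<open>e 0\<close>, which
  lies on the stable axis, bounds \<open>|y|\<close> by \<open>|z|\<close> plus a decaying term.
\<close>

lemma small_height_confines_orbit:
  assumes "0 < \<delta>" "0 < c"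
  shows "\<exists>\<rho>>0. \<exists>k0. \<forall>k\<ge>k0. \<forall>e w. steep_curve c e \<longrightarrow> norm (fst (e 0)) \<le> r / 2 \<longrightarrow> snd (e 0) = 0 \<longrightarrow>
     norm (snd ((f ^^ k) (e w))) \<le> \<rho> \<longrightarrow>
     norm w < \<delta> \<and> (\<forall>j\<le>k. (f ^^ j) (e w) \<in> bidisk r \<and> norm (snd ((f ^^ j) (e w))) < r)"
proof -
  define \<beta> where "\<beta> = b - 2 * L"
  have \<beta>: "0 < \<beta>" using rate_pos by (simp add: \<beta>_def)
  \<comment> \<open>Parameters with \<open>norm w \<ge> \<delta>\<close> start at height at least \<open>c \<delta>\<close>.  One backward step enlarges heights at most
    by \<open>1 / \<beta>\<close>, so that a step back from below height \<open>d\<close> cannot jump over the collar.\<close>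
  define d where "d = min (c * \<delta>) (min (\<beta> * (r / 2)) (r / 2))"
  have d: "0 < d" "d \<le> c * \<delta>" "d \<le> \<beta> * (r / 2)" "d \<le> r / 2"
    using assms \<beta> r_pos by (auto simp: d_def)
  define Z where "Z = bidisk r \<inter> {x :: 'a \<times> 'b. d \<le> norm (snd x)}"
  have Z: "compact Z"
    unfolding Z_def by (intro compact_Int_closed compact_bidisk closed_Collect_le continuous_intros)
  have VZ: "continuous_on Z V" using V_cont by (rule continuous_on_subset) (simp add: Z_def)
  have V_pos: "0 < V x" if "x \<in> Z" for x
    using V_nonneg[of x] V_zero[of x] d(1) that by (force simp: Z_def)
  obtain v0 where v0: "0 < v0" "\<And>x. x \<in> Z \<Longrightarrow> v0 \<le> V x"
    using compact_continuous_pos_bound[OF Z VZ V_pos] by blast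
  have "(0 :: 'a \<times> 'b) \<in> bidisk r" using r_pos by (simp add: mem_bidisk)
  moreover from this have "V 0 = 0" using V_zero[of 0] by simp
  ultimately obtain \<eta> where \<eta>: "0 < \<eta>"
      "\<And>x. x \<in> bidisk r \<Longrightarrow> dist x 0 < \<eta> \<Longrightarrow> dist (V x) 0 < v0"
    using V_cont v0(1) unfolding continuous_on_iff by (metis (no_types))
  define \<rho> where "\<rho> = min (d / 2) (\<eta> / 4)"
  have \<rho>: "0 < \<rho>" "\<rho> < d" "\<rho> \<le> \<eta> / 4" using d(1) \<eta>(1) by (auto simp: \<rho>_def)
  have "(\<lambda>n. (a + \<kappa>) ^ n * (r / 2)) \<longlonglongrightarrow> 0 * (r / 2)"
    using \<kappa> a_nonneg by (intro tendsto_intros LIMSEQ_power_zero) auto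
  then obtain k0 where k0: "\<And>n. n \<ge> k0 \<Longrightarrow> (a + \<kappa>) ^ n * (r / 2) < \<rho>"
    using \<rho>(1) order_tendstoD(2)[of "\<lambda>n. (a + \<kappa>) ^ n * (r / 2)" 0 sequentially \<rho>]
    by (auto simp: eventually_sequentially)
  show ?thesis
  proof (intro exI[of _ \<rho>] exI[of _ k0] conjI[OF \<rho>(1)] allI impI)
    fix k and e :: "'b \<Rightarrow> 'a \<times> 'b" and w
    assume k: "k0 \<le> k" and e: "steep_curve c e" "norm (fst (e 0)) \<le> r / 2" "snd (e 0) = 0"
      and end_small: "norm (snd ((f ^^ k) (e w))) \<le> \<rho>"
    let ?x = "\<lambda>j. (f ^^ j) (e w)"
    have base: "snd ((f ^^ j) (e 0)) = 0" "norm (fst ((f ^^ j) (e 0))) \<le> (a + \<kappa>) ^ j * (r / 2)" for j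
      using stable_axis_orbit[OF e(3,2), of j] r_pos by auto
    have base_le: "norm (fst ((f ^^ j) (e 0))) \<le> r / 2" for j
      using base(2)[of j] mult_right_mono[OF power_rate_le_1[of j], of "r / 2"] r_pos by linarith
    have sec0: "norm (fst (e w - e 0)) \<le> norm (snd (e w - e 0))" "c * norm (w - 0) \<le> norm (snd (e w - e 0))"
      using e(1) unfolding steep_curve_def by blast+
    have sec: "norm (fst (?x j - (f ^^ j) (e 0))) \<le> norm (snd (?x j))" for j
      using secant_iterate[OF sec0(1), of j] base(1)[of j] by simp
    have fst_le: "norm (fst (?x j)) \<le> norm (fst ((f ^^ j) (e 0))) + norm (snd (?x j))" for j
      using sec[of j] norm_triangle_sub[of "fst (?x j)" "fst ((f ^^ j) (e 0))"] by simp
    have in_disk: "?x j \<in> bidisk r" if "norm (snd (?x j)) \<le> r / 2" for j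
      using fst_le[of j] base_le[of j] that r_pos by (simp add: mem_bidisk)
    have backward: "\<beta> * norm (snd (?x j)) \<le> norm (snd (?x (Suc j)))" for j
      using secant_step(2)[of "?x j" "(f ^^ j) (e 0)"] sec[of j] base(1)[of j] base(1)[of "Suc j"]
      by (simp add: \<beta>_def)
    have "dist (V (?x k)) 0 < v0"
    proof (rule \<eta>(2))
      show "?x k \<in> bidisk r" using in_disk end_small \<rho> d by simp
      have "norm (?x k) \<le> norm (fst (?x k)) + norm (snd (?x k))" by (rule norm_le_sum_components)
      also have "\<dots> < \<rho> + \<rho> + \<rho>"
        using fst_le[of k] base(2)[of k] k0[OF k] end_small by linarith
      finally show "dist (?x k) 0 < \<eta>" using \<rho> by (simp add: dist_norm)
    qed
    then have V_end: "V (?x k) < v0" by (simp add: dist_norm)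
    \<comment> \<open>Backwards in time the height can leave the ball of radius \<open>d\<close> only through the compact
      collar \<open>Z\<close>, where \<open>V \<ge> v0\<close>; from there \<open>V\<close> could not decrease to its final value.\<close>
    have below: "norm (snd (?x (k - i))) < d" if "i \<le> k" for i
      using that
    proof (induction i rule: less_induct)
      case (less i)
      show ?case
      proof (cases i)
        case 0
        then show ?thesis using end_small \<rho> by simp
      next
        case (Suc i')
        let ?j = "k - i"
        have j: "?j < k" "Suc ?j = k - i'" using Suc less.prems by auto
        have later: "norm (snd (?x l)) < d" if "?j < l" "l \<le> k" for l
          using less.IH[of "k - l"] that less.prems by simp
        show ?thesis
        proof (rule ccontr)
          assume *: "\<not> norm (snd (?x ?j)) < d"
          have "\<beta> * norm (snd (?x ?j)) \<le> \<beta> * (r / 2)"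
            using backward[of ?j] later[of "Suc ?j"] j d(3) by simp
          then have "norm (snd (?x ?j)) \<le> r / 2" using \<beta> by (simp only: mult_le_cancel_left_pos)
          then have disk: "?x ?j \<in> bidisk r" by (rule in_disk)
          have stay: "v0 \<le> V (?x l) \<and> ?x l \<in> bidisk r" if "?j \<le> l" "l \<le> k" for l
            using that
          proof (induction l rule: dec_induct)
            case base
            then show ?case using v0(2)[of "?x ?j"] disk * by (simp add: Z_def)
          next
            case (step l)
            then have l: "v0 \<le> V (?x l)" "?x l \<in> bidisk r" by auto
            have "?x (Suc l) \<in> bidisk r" using in_disk[of "Suc l"] later[of "Suc l"] step d(4) by simp
            then show ?case using V_mono[OF l(2)] F_eq_f[OF l(2)] l(1) by simp
          qed
          then have "v0 \<le> V (?x k)" using less_imp_le[OF j(1)] by blast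
          then show False using V_end by simp
        qed
      qed
    qed
    have low: "norm (snd (?x j)) < d" if "j \<le> k" for j using below[of "k - j"] that by simp
    have "c * norm w < c * \<delta>" using low[of 0] sec0(2) e(3) d(2) by simp
    then have "norm w < \<delta>" using \<open>0 < c\<close> by (simp only: mult_less_cancel_left_pos)
    moreover have "?x j \<in> bidisk r \<and> norm (snd (?x j)) < r" if "j \<le> k" for j
      using low[OF that] in_disk[of j] d(4) r_pos by auto
    ultimately show "norm w < \<delta> \<and> (\<forall>j\<le>k. ?x j \<in> bidisk r \<and> norm (snd (?x j)) < r)" by blast
  qed
qed

lemma F_iterate_eq:
  assumes "\<And>j. j < k \<Longrightarrow> (f ^^ j) x \<in> bidisk r"
  shows "(F ^^ k) x = (f ^^ k) x"
  using assms by (induction k) (auto simp: F_eq_f)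

text \<open>
  The height \<open>g\<close> of \<open>f\<^sup>k \<circ> e\<close> is an expanding bijection, so \<open>f\<^sup>k \<circ> e \<circ> g\<^sup>-\<^sup>1\<close> is a global graph
  parametrization of the iterated curve.  Over \<open>|z| \<le> \<rho>\<close> only orbits confined to the box are involved:
  there \<open>f\<close> agrees with \<open>F\<close>, \<open>e\<close> is smooth, and the \<open>y\<close>-component and the slopes are small.
\<close>

lemma steep_curves_accumulate:
  assumes "0 < \<delta>" "0 < c"
  shows "\<exists>\<rho>0>0. \<forall>\<rho>. 0 < \<rho> \<longrightarrow> \<rho> \<le> \<rho>0 \<longrightarrow> (\<forall>\<epsilon>>0. \<exists>k0. \<forall>k\<ge>k0. \<forall>e.
     steep_C1_curve (r / 2) c \<delta> e \<longrightarrow> contains_close_disk \<rho> \<epsilon> ((F ^^ k) ` e ` ball 0 \<delta>))"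
proof -
  obtain \<rho>0 k1 where \<rho>0: "0 < \<rho>0" and conf: "\<And>k e w. k \<ge> k1 \<Longrightarrow> steep_curve c e \<Longrightarrow>
     norm (fst (e 0)) \<le> r / 2 \<Longrightarrow> snd (e 0) = 0 \<Longrightarrow> norm (snd ((f ^^ k) (e w))) \<le> \<rho>0 \<Longrightarrow>
     norm w < \<delta> \<and> (\<forall>j\<le>k. (f ^^ j) (e w) \<in> bidisk r \<and> norm (snd ((f ^^ j) (e w))) < r)"
    using small_height_confines_orbit[OF assms] by blast
  have "\<exists>k0. \<forall>k\<ge>k0. \<forall>e. steep_C1_curve (r / 2) c \<delta> e \<longrightarrow>
      contains_close_disk \<rho> \<epsilon> ((F ^^ k) ` e ` ball 0 \<delta>)"
    if \<rho>: "0 < \<rho>" "\<rho> \<le> \<rho>0" and "0 < \<epsilon>" for \<rho> \<epsilon> :: real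
  proof -
    define d where "d = \<epsilon> / 3"
    have d: "0 < d" "2 * d < \<epsilon>" using \<open>0 < \<epsilon>\<close> by (auto simp: d_def)
    obtain k2 where k2: "\<And>k x v. k \<ge> k2 \<Longrightarrow>
       (\<forall>j\<le>k. (f ^^ j) x \<in> bidisk r \<and> norm (snd ((f ^^ j) x)) < r) \<Longrightarrow>
       norm (fst (v 0)) \<le> norm (snd (v 0)) \<Longrightarrow> (\<forall>j<k. v (Suc j) = f' ((f ^^ j) x) (v j)) \<Longrightarrow>
       norm (fst (v k)) \<le> d * norm (snd (v k))"
      using cone_slopes_vanish[OF d(1)] by blast
    have "(\<lambda>n. (a + \<kappa>) ^ n * r) \<longlonglongrightarrow> 0 * r"
      using \<kappa> a_nonneg by (intro tendsto_intros LIMSEQ_power_zero) auto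
    then obtain k3 where k3: "\<And>n. n \<ge> k3 \<Longrightarrow> (a + \<kappa>) ^ n * r < d"
      using d(1) order_tendstoD(2)[of "\<lambda>n. (a + \<kappa>) ^ n * r" 0 sequentially d]
      by (auto simp: eventually_sequentially)
    show ?thesis
    proof (intro exI[of _ "max k1 (max k2 k3)"] allI impI)
      fix k and e :: "'b \<Rightarrow> 'a \<times> 'b"
      assume k: "max k1 (max k2 k3) \<le> k" and "steep_C1_curve (r / 2) c \<delta> e"
      then have e: "steep_curve c e" "continuous_on UNIV e" "norm (fst (e 0)) \<le> r / 2" "snd (e 0) = 0"
        and C1: "C1_on (ball 0 \<delta>) e"
        by (auto simp: steep_C1_curve_def)
      obtain e' where e': "continuous_on (ball 0 \<delta>) e'"
          "\<forall>w\<in>ball 0 \<delta>. (e has_derivative blinfun_apply (e' w)) (at w)"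
        using C1 unfolding C1_on_open[OF open_ball] by blast
      define G where "G w = (f ^^ k) (e w)" for w
      define G' where "G' = iter_deriv f f' e e' k"
      define S where "S = Blinfun (snd :: 'a \<times> 'b \<Rightarrow> 'b)"
      have S: "blinfun_apply S = snd"
        unfolding S_def by (rule bounded_linear_Blinfun_apply[OF bounded_linear_snd])
      let ?g = "\<lambda>w. snd (G w)"
      let ?c = "(b - 2 * L) ^ k * c"
      have c: "0 < ?c" using rate_pos \<open>0 < c\<close> by simp
      have G_cont: "continuous_on UNIV G"
        unfolding G_def by (rule continuous_on_iterates[OF f_cont e(2)])
      have G'_cont: "continuous_on (ball 0 \<delta>) G'"
        unfolding G'_def
        by (rule continuous_on_iter_deriv[OF f_cont f'_cont continuous_on_subset[OF e(2)] e'(1)]) simp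
      have G_deriv: "(G has_derivative blinfun_apply (G' w)) (at w)" if "w \<in> ball 0 \<delta>" for w
        unfolding G_def G'_def by (rule has_derivative_iter_deriv[OF f_deriv]) (use e'(2) that in blast)
      have exp: "?c * norm (x - y) \<le> norm (?g x - ?g y)" for x y
      proof -
        have xy: "norm (fst (e x - e y)) \<le> norm (snd (e x - e y))" "c * norm (x - y) \<le> norm (snd (e x - e y))"
          using e(1) unfolding steep_curve_def by blast+
        have "?c * norm (x - y) \<le> (b - 2 * L) ^ k * norm (snd (e x - e y))"
          using mult_left_mono[OF xy(2), of "(b - 2 * L) ^ k"] rate_pos by (simp add: mult.assoc)
        then show ?thesis using secant_iterate[OF xy(1), of k] by (simp add: G_def)
      qed
      have g_cont: "continuous_on UNIV ?g" by (intro continuous_intros G_cont)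
      have g_deriv: "(?g has_derivative blinfun_apply (S o\<^sub>L G' w)) (at w)" if "w \<in> ball 0 \<delta>" for w
        using bounded_linear.has_derivative[OF bounded_linear_snd G_deriv[OF that]]
        by (simp add: blinfun_compose.rep_eq S o_def)
      have g'_cont: "continuous_on (ball 0 \<delta>) (\<lambda>w. S o\<^sub>L G' w)"
        by (intro continuous_intros G'_cont)
      have gi: "?g (inv ?g z) = z" "inv ?g (?g w) = w" for z w
        using surj_f_inv_f[OF bij_is_surj[OF expanding_bij[OF c exp g_cont]]]
          inv_f_f[OF bij_is_inj[OF expanding_bij[OF c exp g_cont]]] by this+
      obtain \<Gamma> where \<Gamma>: "continuous_on (?g ` ball 0 \<delta>) \<Gamma>"
          "\<And>z. z \<in> ?g ` ball 0 \<delta> \<Longrightarrow> (inv ?g has_derivative blinfun_apply (\<Gamma> z)) (at z)"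
          "\<And>z v. z \<in> ?g ` ball 0 \<delta> \<Longrightarrow> snd (G' (inv ?g z) (\<Gamma> z v)) = v"
        using expanding_inverse_C1[OF c exp g_cont open_ball g_deriv g'_cont] by (auto simp: S)
      have orbit: "norm (inv ?g z) < \<delta> \<and> (\<forall>j\<le>k. (f ^^ j) (e (inv ?g z)) \<in> bidisk r \<and>
          norm (snd ((f ^^ j) (e (inv ?g z)))) < r)" if "norm z \<le> \<rho>" for z
        using conf[of k e "inv ?g z"] k e gi(1)[of z] that \<rho>(2) by (simp add: G_def)
      have z_in: "z \<in> ?g ` ball 0 \<delta>" if "norm z \<le> \<rho>" for z
        using orbit[OF that] gi(1)[of z] by (intro image_eqI[of _ _ "inv ?g z"]) auto
      let ?N = "{0} \<times> cball 0 \<rho> :: ('a \<times> 'b) set"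
      define h where "h x = G (inv ?g (snd x))" for x :: "'a \<times> 'b"
      define h' where "h' x = G' (inv ?g (snd x)) o\<^sub>L \<Gamma> (snd x) o\<^sub>L S" for x :: "'a \<times> 'b"
      have h_deriv: "(h has_derivative blinfun_apply (h' x)) (at x within ?N)" if x: "x \<in> ?N" for x
      proof -
        have z: "norm (snd x) \<le> \<rho>" using x by auto
        have "(inv ?g \<circ> snd has_derivative blinfun_apply (\<Gamma> (snd x)) \<circ> snd) (at x)"
          by (rule diff_chain_at[OF bounded_linear_imp_has_derivative[OF bounded_linear_snd] \<Gamma>(2)[OF z_in[OF z]]])
        from diff_chain_at[OF this, of G "blinfun_apply (G' (inv ?g (snd x)))"]
        have "(h has_derivative blinfun_apply (h' x)) (at x)"
          using G_deriv[of "inv ?g (snd x)"] orbit[OF z]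
          by (simp add: h_def[abs_def] h'_def o_def blinfun_compose.rep_eq S)
        then show ?thesis by (rule has_derivative_at_withinI)
      qed
      have snd_h: "snd (h x) = snd x" for x using gi(1)[of "snd x"] by (simp add: h_def)
      have snd_h': "snd (h' x v) = snd v" if "x \<in> ?N" for x v
        using \<Gamma>(3)[OF z_in, of "snd x" "snd v"] that by (auto simp: h'_def S)
      have h'_cont: "continuous_on ?N h'"
      proof -
        have im: "snd ` ?N \<subseteq> ?g ` ball 0 \<delta>" using z_in by auto
        have ic: "continuous_on (?g ` ball 0 \<delta>) (inv ?g)"
          by (intro continuous_at_imp_continuous_on ballI has_derivative_continuous[OF \<Gamma>(2)])
        have "continuous_on ?N (\<lambda>x. inv ?g (snd x))"
          by (rule continuous_on_compose2[OF ic _ im]) (intro continuous_intros)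
        moreover have "(\<lambda>x. inv ?g (snd x)) ` ?N \<subseteq> ball 0 \<delta>" using orbit by auto
        ultimately have "continuous_on ?N (\<lambda>x. G' (inv ?g (snd x)))"
          by (rule continuous_on_compose2[OF G'_cont])
        moreover have "continuous_on ?N (\<lambda>x. \<Gamma> (snd x))"
          by (rule continuous_on_compose2[OF \<Gamma>(1) _ im]) (intro continuous_intros)
        ultimately show ?thesis unfolding h'_def by (intro continuous_intros)
      qed
      have "C1_embedding ?N h"
      proof (rule C1_embedding_vertical[OF _ h'_cont h_deriv])
        show "continuous_on (h ` ?N) (\<lambda>x. (0, snd x))" by (intro continuous_intros)
        show "(0, snd (h x)) = x" if "x \<in> ?N" for x using that snd_h by (auto simp: prod_eq_iff)
        show "v = w" if "x \<in> ?N" "h' x (0, v) = h' x (0, w)" for x v w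
          using arg_cong[OF that(2), of snd] unfolding snd_h'[OF that(1)] by simp
      qed auto
      moreover have "h ` ?N \<subseteq> (F ^^ k) ` e ` ball 0 \<delta>"
      proof
        fix y assume "y \<in> h ` ?N"
        then obtain z where z: "norm z \<le> \<rho>" "y = G (inv ?g z)" by (auto simp: h_def)
        have "(F ^^ k) (e (inv ?g z)) = y"
          unfolding z(2) G_def using F_iterate_eq[of k "e (inv ?g z)"] orbit[OF z(1)] G_def by auto
        then show "y \<in> (F ^^ k) ` e ` ball 0 \<delta>" using orbit[OF z(1)] by auto
      qed
      moreover have "C1_dist ?N h id < \<epsilon>"
      proof -
        have "C1_dist ?N h id \<le> 2 * d"
        proof (rule C1_dist_id_vertical_le[OF _ _ h_deriv])
          fix x :: "'a \<times> 'b" assume x: "x \<in> ?N"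
          then have z: "norm (snd x) \<le> \<rho>" by auto
          let ?w = "inv ?g (snd x)"
          have orb: "(f ^^ j) (e ?w) \<in> bidisk r" "norm (snd ((f ^^ j) (e ?w))) < r" if "j \<le> k" for j
            using orbit[OF z] that by auto
          have "norm (h x - x) = norm (fst (h x))"
          proof -
            have "h x - x = (fst (h x), 0)" using x snd_h[of x] by (auto simp: prod_eq_iff)
            then show ?thesis by (metis add_0_right norm_Pair norm_zero power_zero_numeral real_sqrt_abs abs_norm_cancel)
          qed
          also have "\<dots> \<le> (a + \<kappa>) ^ k * norm (fst (e ?w))"
            using fst_decay[of k "e ?w"] orb by (simp add: h_def G_def)
          also have "\<dots> \<le> (a + \<kappa>) ^ k * r"
            using orb(1)[of 0] a_nonneg \<kappa>(1) by (intro mult_left_mono) (auto simp: mem_bidisk)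
          also have "\<dots> \<le> d" using k3[of k] k by simp
          finally show "norm (h x - x) \<le> d" .
          fix v :: 'b
          define u where "u = \<Gamma> (snd x) v"
          define vs where "vs j = iter_deriv f f' e e' j ?w u" for j
          have h'v: "h' x (0, v) = vs k" by (simp add: h'_def G'_def S u_def vs_def)
          have w: "?w \<in> ball 0 \<delta>" using orbit[OF z] by simp
          have "norm (fst (e' ?w u)) \<le> norm (snd (e' ?w u))"
          proof (rule derivative_norm_le[where f = "\<lambda>w. fst (e w)" and g = "\<lambda>w. snd (e w)"
              and f' = "\<lambda>v. fst (e' ?w v)" and g' = "\<lambda>v. snd (e' ?w v)" and x = ?w])
            show "((\<lambda>w. fst (e w)) has_derivative (\<lambda>v. fst (e' ?w v))) (at ?w)"
              by (rule bounded_linear.has_derivative[OF bounded_linear_fst]) (use e'(2) w in blast)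
            show "((\<lambda>w. snd (e w)) has_derivative (\<lambda>v. snd (e' ?w v))) (at ?w)"
              by (rule bounded_linear.has_derivative[OF bounded_linear_snd]) (use e'(2) w in blast)
          qed (use e(1) in \<open>simp add: steep_curve_def\<close>)
          then have "norm (fst (vs k)) \<le> d * norm (snd (vs k))"
            by (intro k2[of k "e ?w"]) (use k orb in \<open>auto simp: vs_def\<close>)
          moreover have "snd (vs k) = v" using snd_h'[OF x, of "(0, v)"] h'v by simp
          moreover have "h' x (0, v) - (0, v) = (fst (vs k), 0)"
            using calculation(2) by (simp add: h'v prod_eq_iff)
          ultimately show "norm (h' x (0, v) - (0, v)) \<le> d * norm v" by (simp add: norm_Pair)
        qed (use d \<rho> in auto)
        then show ?thesis using d(2) by linarith
      qed
      ultimately show "contains_close_disk \<rho> \<epsilon> ((F ^^ k) ` e ` ball 0 \<delta>)"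
        unfolding contains_close_disk_def by blast
    qed
  qed
  then show ?thesis using \<rho>0 by blast
qed

end

section \<open>From admissible disks to steep curves\<close>

definition lipschitz_C1_graph ::
    "'a::real_normed_vector \<Rightarrow> real \<Rightarrow> real \<Rightarrow> ('b::real_normed_vector \<Rightarrow> 'a) \<Rightarrow> bool" where
  "lipschitz_C1_graph y0 ey ez \<eta> \<longleftrightarrow> \<eta> ` cball 0 ez \<subseteq> cball y0 ey \<and>
     1-lipschitz_on (cball 0 ez) \<eta> \<and> C1_on (cball 0 ez) \<eta>"

text \<open>
  The graph of \<open>\<eta>\<close> is mapped by \<open>T\<close>, and beyond radius \<open>\<delta>\<close> its image is continued by the images of
  vertical vectors under the derivative \<open>M\<close> of \<open>T\<close> at the base point.  Secants of \<open>\<eta>\<close> lie in the unit cone, where \<open>M\<close> has slopes at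
  most \<open>1/2\<close>, and on a small ball \<open>T\<close> is \<open>C\<^sup>1\<close> close to \<open>M\<close>.  The radius \<open>\<delta>\<close> comes from the uniform
  continuity of \<open>T'\<close> on the box and serves all \<open>\<eta>\<close> at once, although the derivatives of the \<open>\<eta>\<close> need
  not be equicontinuous.
\<close>

lemma steep_extension:
  fixes T :: "'a::euclidean_space \<times> 'b::euclidean_space \<Rightarrow> 'a \<times> 'b"
  assumes T: "\<And>x. x \<in> \<Omega> \<Longrightarrow> (T has_derivative blinfun_apply (T' x)) (at x)" "continuous_on \<Omega> T'"
    and K: "cball y0 ey \<times> cball 0 ez \<subseteq> \<Omega>" and ez: "0 < ez" and c: "0 < c"
    and axis: "\<And>y. y \<in> cball y0 ey \<Longrightarrow> snd (T (y, 0)) = 0"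
    and slope: "\<And>y v. y \<in> cball y0 ey \<Longrightarrow> norm (fst v) \<le> norm (snd v) \<Longrightarrow>
      c * norm (snd v) \<le> norm (snd (T' (y, 0) v)) \<and>
      norm (fst (T' (y, 0) v)) \<le> norm (snd (T' (y, 0) v)) / 2"
  shows "\<exists>\<delta>. 0 < \<delta> \<and> \<delta> \<le> ez \<and> (\<forall>\<eta>. lipschitz_C1_graph y0 ey ez \<eta> \<longrightarrow>
      (\<exists>e. steep_C1_curve (norm (fst (T (\<eta> 0, 0)))) (c / 2) \<delta> e \<and> (\<forall>w\<in>ball 0 \<delta>. e w = T (\<eta> w, w))))"
proof -
  let ?K = "cball y0 ey \<times> cball (0::'b) ez"
  have "uniformly_continuous_on ?K T'"
    by (rule compact_uniformly_continuous[OF continuous_on_subset[OF T(2) K]]) (simp add: compact_Times)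
  moreover have "0 < c / 16" using c by simp
  ultimately obtain d where d: "0 < d" "\<And>x x'. x \<in> ?K \<Longrightarrow> x' \<in> ?K \<Longrightarrow> dist x' x < d \<Longrightarrow> dist (T' x') (T' x) < c / 16"
    unfolding uniformly_continuous_on_def by blast
  define \<delta> where "\<delta> = min ez (d / 4)"
  have \<delta>: "0 < \<delta>" "\<delta> \<le> ez" "2 * \<delta> \<le> d / 2" using ez d(1) by (auto simp: \<delta>_def)
  show ?thesis
  proof (intro exI[of _ \<delta>] conjI[OF \<delta>(1)] conjI[OF \<delta>(2)] allI impI)
    fix \<eta> :: "'b \<Rightarrow> 'a"
    assume "lipschitz_C1_graph y0 ey ez \<eta>"
    then have im: "\<eta> ` cball 0 ez \<subseteq> cball y0 ey" and lip: "1-lipschitz_on (cball 0 ez) \<eta>"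
      and "C1_on (cball 0 ez) \<eta>"
      by (auto simp: lipschitz_C1_graph_def)
    then obtain \<eta>' where \<eta>': "continuous_on (cball 0 ez) \<eta>'"
        "\<forall>z\<in>cball 0 ez. (\<eta> has_derivative blinfun_apply (\<eta>' z)) (at z within cball 0 ez)"
      unfolding C1_on_def by blast
    define \<pi> where "\<pi> = closest_point (cball (0::'b) \<delta>)"
    have \<pi>: "\<pi> w \<in> cball 0 \<delta>" for w
      unfolding \<pi>_def by (rule closest_point_in_set) (use \<delta> in auto)
    have \<pi>_ez: "\<pi> w \<in> cball 0 ez" for w using \<pi>[of w] \<delta>(2) by auto
    have \<pi>_lip: "norm (\<pi> w - \<pi> w') \<le> norm (w - w')" for w w'
      unfolding \<pi>_def dist_norm[symmetric] by (rule closest_point_lipschitz) (use \<delta> in auto)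
    have \<pi>_self: "\<pi> w = w" if "w \<in> cball 0 \<delta>" for w
      unfolding \<pi>_def by (rule closest_point_self[OF that])
    have \<eta>_lip: "norm (\<eta> (\<pi> w) - \<eta> (\<pi> w')) \<le> norm (\<pi> w - \<pi> w')" for w w'
      using lipschitz_onD[OF lip \<pi>_ez \<pi>_ez, of w w'] by (simp add: dist_norm)
    define M where "M = T' (\<eta> 0, 0)"
    define p where "p w = (\<eta> (\<pi> w), \<pi> w)" for w
    let ?x0 = "(\<eta> 0, 0) :: 'a \<times> 'b"
    let ?S = "?K \<inter> cball ?x0 (d / 2)"
    have "\<eta> 0 \<in> \<eta> ` cball 0 ez" using ez by simp
    then have "\<eta> 0 \<in> cball y0 ey" using im by blast
    then have x0: "?x0 \<in> ?K" using ez by simp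
    have p_dist: "norm (p w - p w') \<le> 2 * norm (\<pi> w - \<pi> w')" for w w'
      using norm_le_sum_components[of "p w - p w'"] \<eta>_lip[of w w'] by (simp add: p_def)
    have \<pi>0: "\<pi> 0 = 0" using \<pi>_self \<delta>(1) by simp
    have p_in: "p w \<in> ?S" for w
    proof -
      have "dist (p 0) (p w) \<le> d / 2"
        using p_dist[of w 0] \<pi>[of w] \<pi>0 \<delta>(3) by (simp add: dist_norm norm_minus_commute)
      moreover have "p 0 = ?x0" by (simp add: p_def \<pi>0)
      moreover have "\<eta> (\<pi> w) \<in> cball y0 ey" using im \<pi>_ez[of w] by blast
      then have "p w \<in> ?K" using \<pi>_ez[of w] by (simp add: p_def)
      ultimately show ?thesis by (simp del: mem_Times_iff)
    qed
    have R: "norm ((T x - M x) - (T x' - M x')) \<le> c / 16 * norm (x - x')" if "x \<in> ?S" "x' \<in> ?S" for x x'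
    proof (rule differentiable_bound[where f = "\<lambda>x. T x - M x" and f' = "\<lambda>x. blinfun_apply (T' x - M)"])
      show "convex ?S" by (intro convex_Int convex_Times convex_cball)
      fix x assume x: "x \<in> ?S"
      have "((\<lambda>x. T x - M x) has_derivative (\<lambda>v. T' x v - M v)) (at x)"
        using x K by (intro has_derivative_diff T(1) bounded_linear_imp_has_derivative
            blinfun.bounded_linear_right) auto
      then show "((\<lambda>x. T x - M x) has_derivative blinfun_apply (T' x - M)) (at x within ?S)"
        by (simp add: has_derivative_at_withinI blinfun.diff_left[abs_def] minus_blinfun.rep_eq)
      have "dist x ?x0 < d" using x d(1) by (simp add: dist_commute)
      then show "onorm (blinfun_apply (T' x - M)) \<le> c / 16"
        using less_imp_le[OF d(2)[OF x0 _ \<open>dist x ?x0 < d\<close>]] x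
        by (simp only: M_def norm_blinfun.rep_eq[symmetric] dist_norm) simp
    qed (use that in auto)
    \<comment> \<open>\<open>\<pi>\<close> is a \<open>1\<close>-Lipschitz retraction, so the continuation does not enlarge secants of \<open>\<eta>\<close>.\<close>
    define e where "e w = T (p w) + M (0, w - \<pi> w)" for w
    have diff: "e w - e w' = ((T (p w) - M (p w)) - (T (p w') - M (p w'))) + M (\<eta> (\<pi> w) - \<eta> (\<pi> w'), w - w')"
      for w w'
    proof -
      have "M (\<eta> (\<pi> w) - \<eta> (\<pi> w'), w - w') = M (p w) - M (p w') + (M (0, w - \<pi> w) - M (0, w' - \<pi> w'))"
        unfolding blinfun.diff_right[symmetric] blinfun.add_right[symmetric] by (simp add: p_def)
      then show ?thesis by (simp add: e_def)
    qed
    have steep: "steep_curve (c / 2) e"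
      unfolding steep_curve_def
    proof (intro allI)
      fix w w'
      define v where "v = (\<eta> (\<pi> w) - \<eta> (\<pi> w'), w - w')"
      define E where "E = (T (p w) - M (p w)) - (T (p w') - M (p w'))"
      have eE: "e w - e w' = E + M v" unfolding diff by (simp add: E_def v_def)
      have v: "norm (fst v) \<le> norm (snd v)" using order.trans[OF \<eta>_lip \<pi>_lip] by (simp add: v_def)
      have Mv: "c * norm (w - w') \<le> norm (snd (M v))" "norm (fst (M v)) \<le> norm (snd (M v)) / 2"
        using slope[OF _ v, of "\<eta> 0"] x0 by (auto simp: M_def v_def)
      have "norm (p w - p w') \<le> 2 * norm (w - w')" using p_dist[of w w'] \<pi>_lip[of w w'] by simp
      then have "c / 16 * norm (p w - p w') \<le> c / 16 * (2 * norm (w - w'))"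
        using c by (intro mult_left_mono) auto
      then have E: "norm E \<le> norm (snd (M v)) / 8"
        using R[OF p_in p_in, of w w'] Mv(1) by (simp add: E_def)
      have "norm (snd (M v)) - norm (snd E) \<le> norm (snd (e w - e w'))"
        unfolding eE using norm_triangle_ineq4[of "snd E + snd (M v)" "snd E"] by simp
      then have up: "norm (snd (M v)) - norm (snd (M v)) / 8 \<le> norm (snd (e w - e w'))"
        using E norm_component_le(2)[of E] by linarith
      have "norm (fst (e w - e w')) \<le> norm (fst E) + norm (fst (M v))"
        unfolding eE by (simp add: norm_triangle_ineq)
      then have "norm (fst (e w - e w')) \<le> norm (snd (M v)) / 8 + norm (snd (M v)) / 2"
        using E norm_component_le(1)[of E] Mv(2) by linarith
      then show "norm (fst (e w - e w')) \<le> norm (snd (e w - e w')) \<and>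
          c / 2 * norm (w - w') \<le> norm (snd (e w - e w'))"
        using up Mv(1) norm_ge_zero[of "snd (M v)"] by linarith
    qed
    have T_cont: "continuous_on \<Omega> T"
      by (intro continuous_at_imp_continuous_on ballI has_derivative_continuous[OF T(1)])
    have \<pi>_cont: "continuous_on UNIV \<pi>"
      unfolding \<pi>_def by (rule continuous_on_closest_point) (use \<delta> in auto)
    have \<eta>_cont: "continuous_on (cball 0 ez) \<eta>" using lip by (rule lipschitz_on_continuous_on)
    have "continuous_on UNIV p"
      unfolding p_def
      by (intro continuous_intros \<pi>_cont continuous_on_compose2[OF \<eta>_cont \<pi>_cont]) (use \<pi>_ez in auto)
    then have "continuous_on UNIV (\<lambda>w. T (p w))"
      by (rule continuous_on_compose2[OF T_cont]) (use p_in K in blast)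
    then have e_cont: "continuous_on UNIV e"
      unfolding e_def[abs_def] by (intro continuous_intros \<pi>_cont) auto
    have e_eq: "e w = T (\<eta> w, w)" if "w \<in> cball 0 \<delta>" for w
      using \<pi>_self[OF that] by (simp add: e_def p_def flip: zero_prod_def)
    define I1 where "I1 = Blinfun (\<lambda>y. (y :: 'a, 0 :: 'b))"
    define I2 where "I2 = Blinfun (\<lambda>z. (0 :: 'a, z :: 'b))"
    have I: "blinfun_apply I1 = (\<lambda>y. (y, 0))" "blinfun_apply I2 = (\<lambda>z. (0, z))"
      unfolding I1_def I2_def
      by (intro bounded_linear_Blinfun_apply bounded_linear_Pair bounded_linear_zero bounded_linear_ident)+
    define e' where "e' w = T' (\<eta> w, w) o\<^sub>L ((I1 o\<^sub>L \<eta>' w) + I2)" for w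
    have sub: "ball 0 \<delta> \<subseteq> cball (0::'b) ez" using \<delta>(2) by auto
    have gr: "(\<lambda>w. (\<eta> w, w)) ` ball 0 \<delta> \<subseteq> \<Omega>" using im sub K by auto
    have e'_cont: "continuous_on (ball 0 \<delta>) e'"
    proof -
      have "continuous_on (ball 0 \<delta>) (\<lambda>w. T' (\<eta> w, w))"
        by (rule continuous_on_compose2[OF T(2) _ gr])
          (intro continuous_intros continuous_on_subset[OF \<eta>_cont sub])
      then show ?thesis
        unfolding e'_def[abs_def] by (intro continuous_intros continuous_on_subset[OF \<eta>'(1) sub])
    qed
    have "(e has_derivative blinfun_apply (e' w)) (at w)" if w: "w \<in> ball 0 \<delta>" for w
    proof -
      have "w \<in> interior (cball 0 ez)" using w \<delta>(2) by auto
      then have "(\<eta> has_derivative blinfun_apply (\<eta>' w)) (at w)"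
        using \<eta>'(2) w sub by (metis at_within_interior subsetD)
      then have "((\<lambda>w. (\<eta> w, w)) has_derivative (\<lambda>v. (\<eta>' w v, v))) (at w)"
        by (intro has_derivative_Pair has_derivative_ident)
      moreover have "(\<eta> w, w) \<in> \<Omega>" using gr w by blast
      ultimately have "(T \<circ> (\<lambda>w. (\<eta> w, w)) has_derivative T' (\<eta> w, w) \<circ> (\<lambda>v. (\<eta>' w v, v))) (at w)"
        by (intro diff_chain_at T(1))
      then
      have "((\<lambda>w. T (\<eta> w, w)) has_derivative blinfun_apply (e' w)) (at w)"
        by (simp add: e'_def o_def blinfun_compose.rep_eq plus_blinfun.rep_eq I)
      then show ?thesis
        by (rule has_derivative_transform_within_open[OF _ open_ball w]) (use e_eq in auto)
    qed
    then have "C1_on (ball 0 \<delta>) e" unfolding C1_on_open[OF open_ball] using e'_cont by blast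
    moreover have "snd (T (\<eta> 0, 0)) = 0" using axis x0 by simp
    ultimately have "steep_C1_curve (norm (fst (T (\<eta> 0, 0)))) (c / 2) \<delta> e"
      unfolding steep_C1_curve_def using steep e_cont e_eq[of 0] \<delta>(1) by simp
    then show "\<exists>e. steep_C1_curve (norm (fst (T (\<eta> 0, 0)))) (c / 2) \<delta> e \<and> (\<forall>w\<in>ball 0 \<delta>. e w = T (\<eta> w, w))"
      using e_eq by (intro exI[of _ e]) simp
  qed
qed

text \<open>
  By dimension count \<open>M\<close> maps the axis \<open>UNIV \<times> {0}\<close> onto itself, so that by injectivity nothing outside
  is mapped into it.
\<close>

lemma snd_nonzero_if_axis_invariant:
  fixes M :: "('a::euclidean_space \<times> 'b::euclidean_space) \<Rightarrow>\<^sub>L ('a \<times> 'b)"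
  assumes inj: "inj (blinfun_apply M)" and axis: "\<And>u. snd (M (u, 0)) = 0" and v: "snd v \<noteq> 0"
  shows "snd (M v) \<noteq> 0"
proof
  assume 0: "snd (M v) = 0"
  have lin: "linear (\<lambda>u. fst (M (u, 0)))"
  proof (rule linearI)
    show "fst (M (x + y, 0)) = fst (M (x, 0)) + fst (M (y, 0))" for x y
      using blinfun.add_right[of M "(x, 0)" "(y, 0)"] by simp
    show "fst (M (s *\<^sub>R x, 0)) = s *\<^sub>R fst (M (x, 0))" for s x
      using blinfun.scaleR_right[of M s "(x, 0)"] by simp
  qed
  have "inj (\<lambda>u. fst (M (u, 0)))"
  proof (rule injI)
    fix x y assume "fst (M (x, 0)) = fst (M (y, 0))"
    then have "M (x, 0) = M (y, 0)" using axis by (simp add: prod_eq_iff)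
    then show "x = y" using injD[OF inj] by blast
  qed
  then have "surj (\<lambda>u. fst (M (u, 0)))" by (rule linear_inj_imp_surj[OF lin])
  then obtain u where "fst (M v) = fst (M (u, 0))" unfolding surj_def by blast
  moreover have "snd (M v) = snd (M (u, 0))" unfolding 0 axis ..
  ultimately have "M v = M (u, 0)" by (rule prod_eqI)
  then have "v = (u, 0)" using injD[OF inj] by blast
  then show False using v by simp
qed

context straightened_saddle
begin

lemma F_stable_axis_orbit:
  assumes "snd x = 0" "norm (fst x) \<le> s" "s \<le> r"
  shows "snd ((F ^^ k) x) = 0" "norm (fst ((F ^^ k) x)) \<le> (a + \<kappa>) ^ k * s"
proof -
  have orb: "snd ((f ^^ j) x) = 0" "norm (fst ((f ^^ j) x)) \<le> (a + \<kappa>) ^ j * s" for j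
    using stable_axis_orbit[OF assms] by auto
  have "0 \<le> s" using assms(2) norm_ge_zero order.trans by blast
  then have "(a + \<kappa>) ^ j * s \<le> s" for j using mult_right_mono[OF power_rate_le_1] by fastforce
  then have "(f ^^ j) x \<in> bidisk r" for j
    using order.trans[OF order.trans[OF orb(2)] assms(3)] orb(1) r_pos by (simp add: mem_bidisk)
  then have "(F ^^ k) x = (f ^^ k) x" by (rule F_iterate_eq)
  then show "snd ((F ^^ k) x) = 0" "norm (fst ((F ^^ k) x)) \<le> (a + \<kappa>) ^ k * s"
    using orb by auto
qed

lemma F_axis_step:
  assumes x: "snd x = 0" "norm (fst x) < r"
  shows "norm (fst (F' x v)) \<le> (a + \<kappa>) * norm (fst v) + \<kappa> * norm (snd v)"
    and "(b - \<kappa>) * norm (snd v) \<le> norm (snd (F' x v))"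
proof -
  have xr: "x \<in> bidisk r" using x r_pos by (simp add: mem_bidisk)
  have "norm (fst (F' x v) - B (fst v)) \<le> \<kappa> * norm v"
    using order.trans[OF norm_component_le(1) F'_close[OF xr, of v]] by simp
  also have "\<dots> \<le> \<kappa> * (norm (fst v) + norm (snd v))"
    using \<kappa>(1) norm_le_sum_components[of v] by (intro mult_left_mono) auto
  finally show "norm (fst (F' x v)) \<le> (a + \<kappa>) * norm (fst v) + \<kappa> * norm (snd v)"
    using norm_triangle_sub[of "fst (F' x v)" "B (fst v)"] B_le[of "fst v"]
    by (simp add: algebra_simps)
  have xe: "x = (fst x, 0)" using x by (simp add: prod_eq_iff)
  have "snd (F' x (u, 0)) = 0" for u
  proof (rule has_derivative_constant_direction[where S = "{x. norm (fst x) < r}" and h = snd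
        and l = "\<lambda>u. (u, 0)", OF F_deriv])
    show "open {x :: 'a \<times> 'b. norm (fst x) < r}"
      by (intro open_Collect_less continuous_intros)
    show "bounded_linear (\<lambda>u. (u::'a, 0::'b))"
      by (intro bounded_linear_Pair bounded_linear_zero bounded_linear_ident)
    have F0: "snd (F y) = 0" if "snd y = 0" "norm (fst y) < r" for y
    proof -
      have "y \<in> bidisk r" "y = (fst y, 0)" using that r_pos by (auto simp: mem_bidisk prod_eq_iff)
      then show ?thesis using stable_axis[of "fst y"] F_eq_f[of y] that by (metis less_imp_le)
    qed
    show "snd (F (x + (t, 0))) = snd (F x)" if "x + (t, 0) \<in> {x. norm (fst x) < r}" for t
      using F0[of "x + (t, 0)"] F0[of x] that x by simp
  qed (use x in \<open>auto simp: bounded_linear_snd\<close>)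
  moreover have "F' x v = F' x (fst v, 0) + F' x (0, snd v)"
    unfolding blinfun.add_right[symmetric] by simp
  ultimately have "snd (F' x v) = snd (F' x (0, snd v))" by simp
  moreover have "norm (snd (F' x (0, snd v)) - C (snd v)) \<le> \<kappa> * norm (snd v)"
    using order.trans[OF norm_component_le(2) F'_close[OF xr, of "(0, snd v)"]] by (simp add: norm_Pair)
  ultimately show "(b - \<kappa>) * norm (snd v) \<le> norm (snd (F' x v))"
    using norm_triangle_sub[of "C (snd v)" "snd (F' x v)"] C_ge[of "snd v"]
    by (simp add: norm_minus_commute algebra_simps)
qed

text \<open>
  Entering the ball of radius \<open>r\<close> is an open condition, and on the stable axis the ball is forward
  invariant, so by compactness a common time of entry exists.  From then on the contraction is uniform.
\<close>

lemma stable_set_uniform_entry: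
  assumes Y: "compact Y" and T: "continuous_on Y (\<lambda>y. T y)"
    and axis: "\<And>k y. y \<in> Y \<Longrightarrow> snd ((F ^^ k) (T y)) = 0"
    and conv: "\<And>y. y \<in> Y \<Longrightarrow> (\<lambda>k. (F ^^ k) (T y)) \<longlonglongrightarrow> 0"
    and "0 < s"
  shows "\<exists>J. \<forall>k\<ge>J. \<forall>y\<in>Y. norm (fst ((F ^^ k) (T y))) < s"
proof -
  let ?n = "\<lambda>k y. norm (fst ((F ^^ k) (T y)))"
  have "\<exists>A. open A \<and> A \<inter> Y = ?n k -` {..<r} \<inter> Y" for k
  proof -
    have "continuous_on Y (?n k)"
      by (intro continuous_intros continuous_on_iterates[OF F_cont T])
    then show ?thesis using open_lessThan continuous_on_open_invariant by blast
  qed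
  then obtain A where A: "\<And>k. open (A k)" "\<And>k. A k \<inter> Y = ?n k -` {..<r} \<inter> Y" by metis
  have cover: "Y \<subseteq> (\<Union>k\<in>UNIV. A k)"
  proof
    fix y assume y: "y \<in> Y"
    have "(\<lambda>k. ?n k y) \<longlonglongrightarrow> 0"
      using tendsto_norm_zero[OF tendsto_fst[OF conv[OF y], simplified]] .
    then have "\<forall>\<^sub>F k in sequentially. ?n k y < r" using r_pos by (rule order_tendstoD)
    then obtain k where "?n k y < r" by (auto simp: eventually_sequentially)
    then have "y \<in> ?n k -` {..<r} \<inter> Y" using y by simp
    then show "y \<in> (\<Union>k\<in>UNIV. A k)" using A(2) by blast
  qed
  obtain I where I: "finite I" "Y \<subseteq> (\<Union>k\<in>I. A k)"
    by (rule compactE_image[OF Y A(1) cover])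
  define J0 where "J0 = Max (insert 0 I)"
  have enter: "?n J0 y \<le> r" if y: "y \<in> Y" for y
  proof -
    obtain k where k: "k \<in> I" "y \<in> A k" using I(2) y by blast
    then have "?n k y < r" using A(2)[of k] y by blast
    moreover have "k \<le> J0" using k(1) I(1) by (simp add: J0_def)
    moreover from this have "(F ^^ J0) (T y) = (F ^^ (J0 - k)) ((F ^^ k) (T y))"
      by (metis comp_apply funpow_add le_add_diff_inverse2)
    ultimately have "?n J0 y \<le> (a + \<kappa>) ^ (J0 - k) * r"
      using F_stable_axis_orbit(2)[OF axis[OF y, of k] less_imp_le order_refl] by simp
    then show ?thesis using mult_right_mono[OF power_rate_le_1[of "J0 - k"], of r] r_pos by linarith
  qed
  have "(\<lambda>n. (a + \<kappa>) ^ n * r) \<longlonglongrightarrow> 0 * r"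
    using \<kappa> a_nonneg by (intro tendsto_intros LIMSEQ_power_zero) auto
  then obtain I0 where I0: "\<And>n. n \<ge> I0 \<Longrightarrow> (a + \<kappa>) ^ n * r < s"
    using \<open>0 < s\<close> order_tendstoD(2)[of "\<lambda>n. (a + \<kappa>) ^ n * r" 0 sequentially s]
    by (auto simp: eventually_sequentially)
  show ?thesis
  proof (intro exI[of _ "J0 + I0"] allI impI ballI)
    fix k y assume k: "J0 + I0 \<le> k" and y: "y \<in> Y"
    then have "(F ^^ k) (T y) = (F ^^ (k - J0)) ((F ^^ J0) (T y))"
      by (metis add_leD1 comp_apply funpow_add le_add_diff_inverse2)
    then have "?n k y \<le> (a + \<kappa>) ^ (k - J0) * r"
      using F_stable_axis_orbit(2)[OF axis[OF y] enter[OF y] order_refl] by simp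
    moreover have "(a + \<kappa>) ^ (k - J0) * r < s" by (rule I0) (use k in linarith)
    ultimately show "?n k y < s" by linarith
  qed
qed

text \<open>
  On the stable axis the derivative is block triangular, so the length of the \<open>z\<close>-component of a
  vector is multiplied by at least \<open>b - \<kappa>\<close>, whatever the slope of the vector.  The slope recursion
  \<open>\<sigma> \<mapsto> ((a + \<kappa>) \<sigma> + \<kappa>) / (b - \<kappa>)\<close> has its fixed point at \<open>\<kappa> / (b - a - 2 \<kappa>) \<le> 1/6\<close>.
\<close>

lemma slopes_along_stable_orbits:
  assumes orb: "\<And>j. snd (x j) = 0" "\<And>j. norm (fst (x j)) < r" "\<And>j. v (Suc j) = F' (x j) (v j)"
    and v0: "norm (fst (v 0)) \<le> \<Lambda> * norm (snd (v 0))" "0 \<le> \<Lambda>"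
  shows "(b - \<kappa>) ^ i * norm (snd (v 0)) \<le> norm (snd (v i)) \<and>
    norm (fst (v i)) \<le> (((a + \<kappa>) / (b - \<kappa>)) ^ i * \<Lambda> + 1/6) * norm (snd (v i))"
proof (induction i)
  case 0
  have "norm (fst (v 0)) \<le> (\<Lambda> + 1/6) * norm (snd (v 0))"
    using v0 by (simp add: distrib_right add_increasing2)
  then show ?case by simp
next
  case (Suc i)
  define q where "q = (a + \<kappa>) / (b - \<kappa>)"
  have den: "0 < b - \<kappa>" using \<kappa> a_nonneg by linarith
  have q: "0 \<le> q" "(b - \<kappa>) * q = a + \<kappa>" using den a_nonneg \<kappa>(1) by (auto simp: q_def)
  let ?\<sigma> = "q ^ i * \<Lambda> + 1/6"
  have IH: "(b - \<kappa>) ^ i * norm (snd (v 0)) \<le> norm (snd (v i))"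
    "norm (fst (v i)) \<le> ?\<sigma> * norm (snd (v i))" using Suc by (auto simp: q_def)
  have step: "norm (fst (v (Suc i))) \<le> (a + \<kappa>) * norm (fst (v i)) + \<kappa> * norm (snd (v i))"
    "(b - \<kappa>) * norm (snd (v i)) \<le> norm (snd (v (Suc i)))"
    using F_axis_step[of "x i" "v i", OF orb(1) orb(2)] by (auto simp: orb(3))
  have 1: "(b - \<kappa>) ^ Suc i * norm (snd (v 0)) \<le> norm (snd (v (Suc i)))"
    using mult_left_mono[OF IH(1) less_imp_le[OF den]] step(2) by (simp add: mult.assoc)
  have "norm (fst (v (Suc i))) \<le> ((a + \<kappa>) * ?\<sigma> + \<kappa>) * norm (snd (v i))"
    using step(1) mult_left_mono[OF IH(2), of "a + \<kappa>"] a_nonneg \<kappa>(1) by (simp add: algebra_simps)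
  also have "\<dots> \<le> ((b - \<kappa>) * (q ^ Suc i * \<Lambda> + 1/6)) * norm (snd (v i))"
  proof (rule mult_right_mono)
    have "(b - \<kappa>) * (q ^ Suc i * \<Lambda> + 1/6) = (a + \<kappa>) * (q ^ i * \<Lambda>) + (b - \<kappa>) / 6"
      unfolding q(2)[symmetric] by (simp add: algebra_simps)
    moreover have "(a + \<kappa>) * ?\<sigma> + \<kappa> = (a + \<kappa>) * (q ^ i * \<Lambda>) + ((a + \<kappa>) / 6 + \<kappa>)"
      by (simp add: distrib_left)
    moreover have "(a + \<kappa>) / 6 + \<kappa> \<le> (b - \<kappa>) / 6"
      using \<kappa>(3) by (simp add: add_divide_distrib diff_divide_distrib)
    ultimately show "(a + \<kappa>) * ?\<sigma> + \<kappa> \<le> (b - \<kappa>) * (q ^ Suc i * \<Lambda> + 1/6)" by linarith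
  qed simp
  also have "\<dots> = (q ^ Suc i * \<Lambda> + 1/6) * ((b - \<kappa>) * norm (snd (v i)))" by simp
  also have "\<dots> \<le> (q ^ Suc i * \<Lambda> + 1/6) * norm (snd (v (Suc i)))"
    using step(2) q(1) v0(2) by (intro mult_left_mono) auto
  finally show ?case using 1 by (simp add: q_def)
qed

text \<open>
  Here \<open>\<Psi>\<close> is a local chart in which the stable manifold is the \<open>y\<close>-axis.  After \<open>J\<close> steps the base
  points of all disks are in the box and compactness bounds the slopes of transversal vectors by some
  \<open>\<Lambda>\<close>, possibly large; \<open>i\<close> further steps along the stable axis reduce the slopes to \<open>1/2\<close>.
\<close>

lemma disks_through_stable_set_become_steep:
  fixes \<Psi> :: "'a \<times> 'b \<Rightarrow> 'a \<times> 'b"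
  assumes \<Omega>: "open \<Omega>" "cball y0 ey \<times> cball 0 ez \<subseteq> \<Omega>" and ez: "0 < ez"
    and \<Psi>: "\<And>x. x \<in> \<Omega> \<Longrightarrow> (\<Psi> has_derivative blinfun_apply (\<Psi>' x)) (at x)" "continuous_on \<Omega> \<Psi>'"
      "\<And>x. x \<in> \<Omega> \<Longrightarrow> inj (blinfun_apply (\<Psi>' x))"
    and axis: "\<And>k y. (y, 0) \<in> \<Omega> \<Longrightarrow> snd ((F ^^ k) (\<Psi> (y, 0))) = 0"
    and conv: "\<And>y. (y, 0) \<in> \<Omega> \<Longrightarrow> (\<lambda>k. (F ^^ k) (\<Psi> (y, 0))) \<longlonglongrightarrow> 0"
  shows "\<exists>K c \<delta>. 0 < c \<and> 0 < \<delta> \<and> \<delta> \<le> ez \<and> (\<forall>\<eta>. lipschitz_C1_graph y0 ey ez \<eta> \<longrightarrow>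
      (\<exists>e. steep_C1_curve (r / 2) c \<delta> e \<and> (\<forall>w\<in>ball 0 \<delta>. e w = (F ^^ K) (\<Psi> (\<eta> w, w)))))"
proof -
  let ?Y = "cball y0 ey"
  let ?T = "\<lambda>k x. (F ^^ k) (\<Psi> x)" and ?T' = "iter_deriv F F' \<Psi> \<Psi>'"
  have Y\<Omega>: "(y, 0) \<in> \<Omega>" if "y \<in> ?Y" for y using \<Omega>(2) that ez by auto
  have \<Psi>_cont: "continuous_on \<Omega> \<Psi>"
    by (intro continuous_at_imp_continuous_on ballI has_derivative_continuous[OF \<Psi>(1)])
  have T: "(?T k has_derivative blinfun_apply (?T' k x)) (at x)" if "x \<in> \<Omega>" for k x
    by (rule has_derivative_iter_deriv[where F' = F' and T' = \<Psi>']) (intro F_deriv \<Psi>(1)[OF that])+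
  have T'_cont: "continuous_on \<Omega> (?T' k)" for k
    by (rule continuous_on_iter_deriv[OF F_cont F'_cont \<Psi>_cont \<Psi>(2)])
  have ax: "continuous_on ?Y (\<lambda>y. (y, 0))" "(\<lambda>y. (y, 0)) ` ?Y \<subseteq> \<Omega>"
    using Y\<Omega> by (auto intro!: continuous_intros)
  have "\<exists>J. \<forall>k\<ge>J. \<forall>y\<in>?Y. norm (fst (?T k (y, 0))) < r / 2"
    using r_pos Y\<Omega> axis conv
    by (intro stable_set_uniform_entry continuous_on_compose2[OF \<Psi>_cont ax] compact_cball) auto
  then obtain J where J: "\<And>k y. k \<ge> J \<Longrightarrow> y \<in> ?Y \<Longrightarrow> norm (fst (?T k (y, 0))) < r / 2" by blast
  have T'_axis: "snd (?T' k (y, 0) (u, 0)) = 0" if "y \<in> ?Y" for k y u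
  proof (rule has_derivative_constant_direction[where h = snd and l = "\<lambda>u. (u, 0)",
        OF T[OF Y\<Omega>[OF that]] \<Omega>(1) Y\<Omega>[OF that]])
    show "bounded_linear (\<lambda>u. (u::'a, 0::'b))"
      by (intro bounded_linear_Pair bounded_linear_zero bounded_linear_ident)
  qed (use axis Y\<Omega>[OF that] in \<open>auto simp: bounded_linear_snd\<close>)
  have T'_snd: "snd (?T' k (y, 0) v) \<noteq> 0" if "y \<in> ?Y" "snd v \<noteq> 0" for k y v
    by (rule snd_nonzero_if_axis_invariant[OF inj_iter_deriv[where F' = F' and T' = \<Psi>',
            OF F'_inj \<Psi>(3)[OF Y\<Omega>[OF that(1)]]] T'_axis[OF that(1)] that(2)])
  \<comment> \<open>Base points together with the vectors of the unit cone, normalized to have \<open>|z| = 1\<close>.\<close>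
  let ?D = "?Y \<times> (cball (0::'a) 1 \<times> sphere (0::'b) 1)"
  have D: "compact ?D" by (intro compact_Times compact_cball compact_sphere)
  have TJ: "continuous_on ?D (\<lambda>p. ?T' J (fst p, 0) (snd p))"
  proof -
    have "continuous_on ?D (\<lambda>p. ?T' J (fst p, 0))"
      by (rule continuous_on_compose2[OF T'_cont]) (use Y\<Omega> in \<open>auto intro!: continuous_intros\<close>)
    then show ?thesis by (intro continuous_intros)
  qed
  have "\<exists>c>0. \<forall>p\<in>?D. c \<le> norm (snd (?T' J (fst p, 0) (snd p)))"
  proof (rule compact_continuous_pos_bound[OF D])
    show "continuous_on ?D (\<lambda>p. norm (snd (?T' J (fst p, 0) (snd p))))"
      by (intro continuous_intros TJ)
    fix p assume "p \<in> ?D"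
    then have "fst p \<in> ?Y" "norm (snd (snd p)) = 1" by auto
    then show "0 < norm (snd (?T' J (fst p, 0) (snd p)))"
      using T'_snd[of "fst p" "snd p" J] by (metis norm_zero zero_less_norm_iff zero_neq_one)
  qed
  then obtain c where c: "0 < c" "\<And>p. p \<in> ?D \<Longrightarrow> c \<le> norm (snd (?T' J (fst p, 0) (snd p)))" by blast
  have "bounded ((\<lambda>p. ?T' J (fst p, 0) (snd p)) ` ?D)"
    by (intro compact_imp_bounded compact_continuous_image TJ D)
  then obtain R where R: "\<And>p. p \<in> ?D \<Longrightarrow> norm (?T' J (fst p, 0) (snd p)) \<le> R"
    unfolding bounded_iff by blast
  define \<Lambda> where "\<Lambda> = \<bar>R\<bar> / c"
  have \<Lambda>: "0 \<le> \<Lambda>" using c by (simp add: \<Lambda>_def)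
  have at_J: "c * norm (snd v) \<le> norm (snd (?T' J (y, 0) v)) \<and>
      norm (fst (?T' J (y, 0) v)) \<le> \<Lambda> * norm (snd (?T' J (y, 0) v))"
    if y: "y \<in> ?Y" and v: "norm (fst v) \<le> norm (snd v)" for y v
  proof (cases "snd v = 0")
    case True
    then have "v = 0" using v by (simp add: prod_eq_iff)
    then show ?thesis by simp
  next
    case False
    let ?n = "norm (snd v)"
    define u where "u = (1 / ?n) *\<^sub>R v"
    have u: "(y, u) \<in> ?D" using y v False by (simp add: u_def mem_Times_iff)
    have vu: "v = ?n *\<^sub>R u" using False by (simp add: u_def)
    have *: "norm (snd (?T' J (y, 0) v)) = ?n * norm (snd (?T' J (y, 0) u))"
      "norm (fst (?T' J (y, 0) v)) = ?n * norm (fst (?T' J (y, 0) u))"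
      by (subst vu, simp add: blinfun.scaleR_right)+
    have 1: "c \<le> norm (snd (?T' J (y, 0) u))" using c(2)[OF u] by simp
    have "norm (fst (?T' J (y, 0) u)) \<le> \<bar>R\<bar>"
      using order.trans[OF norm_component_le(1) R[OF u]] by simp
    also have "\<bar>R\<bar> = \<Lambda> * c" using c(1) by (simp add: \<Lambda>_def)
    also have "\<dots> \<le> \<Lambda> * norm (snd (?T' J (y, 0) u))" using 1 \<Lambda> by (intro mult_left_mono)
    finally have "?n * norm (fst (?T' J (y, 0) u)) \<le> ?n * (\<Lambda> * norm (snd (?T' J (y, 0) u)))"
      by (intro mult_left_mono) auto
    moreover have "?n * c \<le> ?n * norm (snd (?T' J (y, 0) u))" using 1 by (intro mult_left_mono) auto
    ultimately show ?thesis unfolding * by (simp add: mult.left_commute mult.commute)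
  qed
  define q where "q = (a + \<kappa>) / (b - \<kappa>)"
  have den: "0 < b - \<kappa>" using \<kappa> a_nonneg by linarith
  have q: "0 \<le> q" "q < 1" using den a_nonneg \<kappa> by (auto simp: q_def field_simps)
  have "(\<lambda>n. q ^ n * \<Lambda>) \<longlonglongrightarrow> 0 * \<Lambda>"
    using q by (intro tendsto_intros LIMSEQ_power_zero) auto
  then obtain i where i: "q ^ i * \<Lambda> < 1/3"
    using order_tendstoD(2)[of "\<lambda>n. q ^ n * \<Lambda>" 0 sequentially "1/3"]
    by (auto simp: eventually_sequentially)
  define c' where "c' = (b - \<kappa>) ^ i * c"
  have c': "0 < c'" using den c(1) by (simp add: c'_def)
  have at_K: "c' * norm (snd v) \<le> norm (snd (?T' (J + i) (y, 0) v)) \<and>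
      norm (fst (?T' (J + i) (y, 0) v)) \<le> norm (snd (?T' (J + i) (y, 0) v)) / 2"
    if y: "y \<in> ?Y" and v: "norm (fst v) \<le> norm (snd v)" for y v
  proof -
    let ?v = "\<lambda>j. ?T' (J + j) (y, 0) v"
    have "norm (fst (?T (J + j) (y, 0))) < r" for j using J[of "J + j" y] y r_pos by auto
    then have S: "(b - \<kappa>) ^ i * norm (snd (?v 0)) \<le> norm (snd (?v i))"
      "norm (fst (?v i)) \<le> (q ^ i * \<Lambda> + 1/6) * norm (snd (?v i))"
      using slopes_along_stable_orbits[of "\<lambda>j. ?T (J + j) (y, 0)" ?v \<Lambda> i] at_J[OF y v] axis Y\<Omega>[OF y] \<Lambda>
      by (auto simp: q_def)
    have "(q ^ i * \<Lambda> + 1/6) * norm (snd (?v i)) \<le> 1/2 * norm (snd (?v i))"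
      using i by (intro mult_right_mono) auto
    moreover have "c' * norm (snd v) \<le> (b - \<kappa>) ^ i * norm (snd (?v 0))"
      using mult_left_mono[of "c * norm (snd v)" "norm (snd (?v 0))" "(b - \<kappa>) ^ i"] at_J[OF y v] den
      by (simp add: c'_def mult.assoc)
    ultimately show ?thesis using S by auto
  qed
  have "snd (?T (J + i) (y, 0)) = 0" if "y \<in> ?Y" for y using axis[OF Y\<Omega>[OF that]] .
  then have "\<exists>\<delta>. 0 < \<delta> \<and> \<delta> \<le> ez \<and> (\<forall>\<eta>. lipschitz_C1_graph y0 ey ez \<eta> \<longrightarrow>
      (\<exists>e. steep_C1_curve (norm (fst (?T (J + i) (\<eta> 0, 0)))) (c' / 2) \<delta> e \<and>
         (\<forall>w\<in>ball 0 \<delta>. e w = ?T (J + i) (\<eta> w, w))))"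
    by (intro steep_extension[OF T T'_cont \<Omega>(2) ez c' _ at_K])
  then obtain \<delta> where \<delta>: "0 < \<delta>" "\<delta> \<le> ez" and ext: "\<forall>\<eta>. lipschitz_C1_graph y0 ey ez \<eta> \<longrightarrow>
      (\<exists>e. steep_C1_curve (norm (fst (?T (J + i) (\<eta> 0, 0)))) (c' / 2) \<delta> e \<and>
         (\<forall>w\<in>ball 0 \<delta>. e w = ?T (J + i) (\<eta> w, w)))"
    by blast
  have "\<exists>e. steep_C1_curve (r / 2) (c' / 2) \<delta> e \<and> (\<forall>w\<in>ball 0 \<delta>. e w = ?T (J + i) (\<eta> w, w))"
    if \<eta>: "lipschitz_C1_graph y0 ey ez \<eta>" for \<eta>
  proof -
    have "\<eta> 0 \<in> \<eta> ` cball 0 ez" using ez by simp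
    then have "\<eta> 0 \<in> ?Y" using \<eta> unfolding lipschitz_C1_graph_def by blast
    then have "norm (fst (?T (J + i) (\<eta> 0, 0))) \<le> r / 2" using J[of "J + i" "\<eta> 0"] by simp
    then show ?thesis using ext \<eta> unfolding steep_C1_curve_def by (meson order.trans)
  qed
  moreover have "0 < c' / 2" using c' by simp
  ultimately show ?thesis using \<delta> by blast
qed

lemma graphs_through_stable_set_accumulate:
  fixes \<Psi> :: "'a \<times> 'b \<Rightarrow> 'a \<times> 'b"
  assumes \<Omega>: "open \<Omega>" "cball y0 ey \<times> cball 0 ez \<subseteq> \<Omega>" and ez: "0 < ez"
    and \<Psi>: "\<And>x. x \<in> \<Omega> \<Longrightarrow> (\<Psi> has_derivative blinfun_apply (\<Psi>' x)) (at x)" "continuous_on \<Omega> \<Psi>'"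
      "\<And>x. x \<in> \<Omega> \<Longrightarrow> inj (blinfun_apply (\<Psi>' x))"
    and axis: "\<And>k y. (y, 0) \<in> \<Omega> \<Longrightarrow> snd ((F ^^ k) (\<Psi> (y, 0))) = 0"
    and conv: "\<And>y. (y, 0) \<in> \<Omega> \<Longrightarrow> (\<lambda>k. (F ^^ k) (\<Psi> (y, 0))) \<longlonglongrightarrow> 0"
  shows "\<exists>\<rho>0>0. \<forall>\<rho>. 0 < \<rho> \<longrightarrow> \<rho> \<le> \<rho>0 \<longrightarrow> (\<forall>\<epsilon>>0. \<exists>m0. \<forall>m\<ge>m0. \<forall>\<eta>.
      lipschitz_C1_graph y0 ey ez \<eta> \<longrightarrow>
      contains_close_disk \<rho> \<epsilon> ((F ^^ m) ` \<Psi> ` (\<lambda>z. (\<eta> z, z)) ` cball 0 ez))"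
proof -
  have "\<exists>K c \<delta>. 0 < c \<and> 0 < \<delta> \<and> \<delta> \<le> ez \<and> (\<forall>\<eta>. lipschitz_C1_graph y0 ey ez \<eta> \<longrightarrow>
      (\<exists>e. steep_C1_curve (r / 2) c \<delta> e \<and> (\<forall>w\<in>ball 0 \<delta>. e w = (F ^^ K) (\<Psi> (\<eta> w, w)))))"
    by (rule disks_through_stable_set_become_steep[OF \<Omega> ez \<Psi> axis conv])
  then obtain K c \<delta> where c: "0 < c" and \<delta>: "0 < \<delta>" "\<delta> \<le> ez"
    and curve: "\<forall>\<eta>. lipschitz_C1_graph y0 ey ez \<eta> \<longrightarrow>
      (\<exists>e. steep_C1_curve (r / 2) c \<delta> e \<and> (\<forall>w\<in>ball 0 \<delta>. e w = (F ^^ K) (\<Psi> (\<eta> w, w))))"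
    by blast
  obtain \<rho>0 where \<rho>0: "0 < \<rho>0" and acc: "\<forall>\<rho>. 0 < \<rho> \<longrightarrow> \<rho> \<le> \<rho>0 \<longrightarrow> (\<forall>\<epsilon>>0. \<exists>k0. \<forall>k\<ge>k0. \<forall>e.
     steep_C1_curve (r / 2) c \<delta> e \<longrightarrow> contains_close_disk \<rho> \<epsilon> ((F ^^ k) ` e ` ball 0 \<delta>))"
    using steep_curves_accumulate[OF \<delta>(1) c] by blast
  show ?thesis
  proof (intro exI[of _ \<rho>0] conjI[OF \<rho>0] allI impI)
    fix \<rho> \<epsilon> :: real assume "0 < \<rho>" "\<rho> \<le> \<rho>0" "0 < \<epsilon>"
    then obtain k0 where k0: "\<forall>k\<ge>k0. \<forall>e. steep_C1_curve (r / 2) c \<delta> e \<longrightarrow>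
        contains_close_disk \<rho> \<epsilon> ((F ^^ k) ` e ` ball 0 \<delta>)"
      using acc by blast
    show "\<exists>m0. \<forall>m\<ge>m0. \<forall>\<eta>. lipschitz_C1_graph y0 ey ez \<eta> \<longrightarrow>
      contains_close_disk \<rho> \<epsilon> ((F ^^ m) ` \<Psi> ` (\<lambda>z. (\<eta> z, z)) ` cball 0 ez)"
    proof (intro exI[of _ "k0 + K"] allI impI)
      fix m and \<eta> :: "'b \<Rightarrow> 'a"
      assume m: "k0 + K \<le> m" and \<eta>: "lipschitz_C1_graph y0 ey ez \<eta>"
      obtain e where e: "steep_C1_curve (r / 2) c \<delta> e"
        and e_eq: "\<forall>w\<in>ball 0 \<delta>. e w = (F ^^ K) (\<Psi> (\<eta> w, w))"
        using curve \<eta> by blast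
      have "k0 \<le> m - K" using m by simp
      then have "contains_close_disk \<rho> \<epsilon> ((F ^^ (m - K)) ` e ` ball 0 \<delta>)" using k0 e by blast
      moreover have "(F ^^ (m - K)) ` e ` ball 0 \<delta> \<subseteq> (F ^^ m) ` \<Psi> ` (\<lambda>z. (\<eta> z, z)) ` cball 0 ez"
      proof
        fix x assume "x \<in> (F ^^ (m - K)) ` e ` ball 0 \<delta>"
        then obtain w where w: "w \<in> ball 0 \<delta>" "x = (F ^^ (m - K)) (e w)" by blast
        have "F ^^ m = F ^^ (m - K) \<circ> F ^^ K" using m by (simp flip: funpow_add)
        then have "x = (F ^^ m) (\<Psi> (\<eta> w, w))" using e_eq w by simp
        moreover have "w \<in> cball 0 ez" using w(1) \<delta>(2) by auto
        ultimately show "x \<in> (F ^^ m) ` \<Psi> ` (\<lambda>z. (\<eta> z, z)) ` cball 0 ez" by blast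
      qed
      ultimately show "contains_close_disk \<rho> \<epsilon> ((F ^^ m) ` \<Psi> ` (\<lambda>z. (\<eta> z, z)) ` cball 0 ez)"
        by (rule contains_close_disk_mono)
    qed
  qed
qed

end

section \<open>The inclination lemma\<close>

text \<open>
  The bound on the chosen derivative turns into a Lipschitz constant because balls are convex.
\<close>

lemma graph_disksE:
  fixes c :: "real^'s::finite" and d :: "(('s, 'u::finite) phase) set"
  assumes "d \<in> graph_disks c ey ez"
  obtains \<eta> where "d = (\<lambda>z. (\<eta> z, z)) ` cball 0 ez" "lipschitz_C1_graph c ey ez \<eta>"
proof -
  obtain \<eta> where d: "d = (\<lambda>z. (\<eta> z, z)) ` cball 0 ez" and C1: "C1_on (cball 0 ez) \<eta>"
    and near: "\<forall>z\<in>cball 0 ez. norm (\<eta> z - c) \<le> ey"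
    and slope: "\<forall>z\<in>cball 0 ez. onorm (frechet_derivative \<eta> (at z within cball 0 ez)) \<le> 1"
    using assms unfolding graph_disks_def by blast
  have deriv: "(\<eta> has_derivative frechet_derivative \<eta> (at z within cball 0 ez)) (at z within cball 0 ez)"
    if "z \<in> cball 0 ez" for z
    using C1 that unfolding C1_on_def frechet_derivative_works[symmetric] differentiable_def by blast
  have "1-lipschitz_on (cball 0 ez) \<eta>"
  proof (rule lipschitz_onI)
    fix z z' :: "real^'u" assume z: "z \<in> cball 0 ez" "z' \<in> cball 0 ez"
    have "norm (\<eta> z - \<eta> z') \<le> 1 * norm (z - z')"
      by (rule differentiable_bound[OF convex_cball deriv _ z]) (use slope in blast)+
    then show "dist (\<eta> z) (\<eta> z') \<le> 1 * dist z z'" by (simp add: dist_norm)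
  qed simp
  moreover have "\<eta> ` cball 0 ez \<subseteq> cball c ey"
    using near by (auto simp: dist_norm norm_minus_commute)
  ultimately show thesis using that d C1 unfolding lipschitz_C1_graph_def by blast
qed

lemma bounded_linear_map_prodD:
  assumes "bounded_linear (map_prod B C)"
  shows "bounded_linear B" "bounded_linear C"
proof -
  have "bounded_linear (\<lambda>y. fst (map_prod B C (y, 0)))"
    by (intro bounded_linear_compose[OF bounded_linear_fst] bounded_linear_compose[OF assms]
        bounded_linear_Pair bounded_linear_ident bounded_linear_zero)
  then show "bounded_linear B" by simp
  have "bounded_linear (\<lambda>z. snd (map_prod B C (0, z)))"
    by (intro bounded_linear_compose[OF bounded_linear_snd] bounded_linear_compose[OF assms]
        bounded_linear_Pair bounded_linear_ident bounded_linear_zero)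
  then show "bounded_linear C" by simp
qed

lemma bij_linear_lower_bound:
  fixes C :: "'a::euclidean_space \<Rightarrow> 'a"
  assumes "linear C" "bij C"
  shows "1 / onorm (inv C) * norm z \<le> norm (C z)"
proof -
  have "bounded_linear (inv C)"
    using inj_linear_imp_inv_linear[OF assms(1) bij_is_inj[OF assms(2)]] by (simp add: linear_conv_bounded_linear)
  then have le: "norm (inv C (C z)) \<le> onorm (inv C) * norm (C z)" "0 \<le> onorm (inv C)"
    using onorm onorm_pos_le by blast+
  then show ?thesis
    using inv_f_f[OF bij_is_inj[OF assms(2)], of z] by (cases "onorm (inv C) = 0") (auto simp: field_simps)
qed

text \<open>
  Exponential decay with rate \<open>q\<close> is inherited by \<open>(F ^^ k) x\<close>, with the constant
  \<open>c q\<^sup>k\<close>.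
\<close>

lemma local_stable_manifold_iterates:
  assumes W: "local_stable_manifold F S W" and x: "x \<in> W"
  shows "(F ^^ k) x \<in> W" "(\<lambda>k. (F ^^ k) x) \<longlonglongrightarrow> 0"
proof -
  obtain G q where q: "0 < q" "q < 1"
    and W_eq: "W = {x. (\<forall>k. (F ^^ k) x \<in> G) \<and> (\<exists>c. \<forall>k. norm ((F ^^ k) x) \<le> c * q ^ k)}"
    using W unfolding local_stable_manifold_def by blast
  obtain c where c: "\<And>k. norm ((F ^^ k) x) \<le> c * q ^ k" and G: "\<And>k. (F ^^ k) x \<in> G"
    using x unfolding W_eq by blast
  have iter: "(F ^^ j) ((F ^^ k) x) = (F ^^ (j + k)) x" for j by (simp add: funpow_add)
  have "norm ((F ^^ (j + k)) x) \<le> c * q ^ k * q ^ j" for j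
    using c[of "j + k"] by (simp add: power_add mult.assoc mult.commute mult.left_commute)
  then show "(F ^^ k) x \<in> W" unfolding W_eq using G by (auto simp: iter)
  have "(\<lambda>k. c * q ^ k) \<longlonglongrightarrow> c * 0"
    using q by (intro tendsto_intros LIMSEQ_power_zero) auto
  then have "(\<lambda>k. c * q ^ k) \<longlonglongrightarrow> 0" by simp
  then show "(\<lambda>k. (F ^^ k) x) \<longlonglongrightarrow> 0"
    by (rule Lim_null_comparison[rotated]) (use c in auto)
qed

lemma open_contains_bidisk:
  fixes N :: "('a::real_normed_vector \<times> 'b::real_normed_vector) set"
  assumes "open N" "0 \<in> N"
  shows "\<exists>r>0. bidisk r \<subseteq> N"
proof -
  obtain e where e: "0 < e" "ball 0 e \<subseteq> N" using assms open_contains_ball by blast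
  have "bidisk (e / 3) \<subseteq> (ball 0 e :: ('a \<times> 'b) set)"
  proof
    fix x :: "'a \<times> 'b" assume "x \<in> bidisk (e / 3)"
    then have "norm x < e" using norm_le_sum_components[of x] e(1) unfolding mem_bidisk by linarith
    then show "x \<in> ball 0 e" by simp
  qed
  then show ?thesis using e by (intro exI[of _ "e / 3"]) auto
qed

theorem lemma2p1:
  fixes F :: "('s::finite, 'u::finite) phase \<Rightarrow> ('s, 'u) phase"
    and B :: "real^'s \<Rightarrow> real^'s" and C :: "real^'u \<Rightarrow> real^'u"
    and Q Ws Wcu ws wcu U0 U1 :: "('s, 'u) phase set"
    and p :: "('s, 'u) phase" and yp :: "real^'s"
    and \<phi> :: "('s, 'u) phase \<Rightarrow> ('s, 'u) phase"
    and ey0 ez0 ey1 ez1 :: real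
  assumes F_diffeo: "surj F" "C1_diffeo_on UNIV F"
    and Q: "open Q" "connected Q" "bounded Q" "0 \<in> Q" "F ` closure Q \<subseteq> Q"
    and F_0: "F 0 = 0"
    and DF_0: "(F has_derivative map_prod B C) (at 0)"
    and C_bij: "bij C"
    and norms: "onorm B < 1" "onorm B < 1 / onorm (inv C)"
    and eigenvalues: "eigenvalue_count (map_prod B C) (\<lambda>l. cmod l < 1) = CARD('s)"
        "eigenvalue_count (map_prod B C) (\<lambda>l. cmod l \<ge> 1) = CARD('u)"
    and subspaces: "spectral_subspace (map_prod B C) (\<lambda>l. cmod l < 1) = UNIV \<times> {0}"
        "spectral_subspace (map_prod B C) (\<lambda>l. cmod l \<ge> 1) = {0} \<times> UNIV"
    and Ws: "local_stable_manifold F (UNIV \<times> {0}) Ws"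
    and Wcu: "local_center_unstable_manifold F B C Wcu"
    and unstable: "strongly_conditionally_unstable F Ws Wcu"
    and straight: "Ws \<subseteq> UNIV \<times> {0}" "Wcu \<subseteq> {0} \<times> UNIV"
    and homoclinic: "C1_disk CARD('s) ws" "ws \<subseteq> global_manifold F Ws"
        "C1_disk CARD('u) wcu" "wcu \<subseteq> global_manifold F Wcu"
        "transversal_at wcu ws p" "p \<noteq> 0" "p = (yp, 0)" "p \<in> Ws"
    and U0: "open U0" "0 \<in> U0" "p \<notin> closure U0"
        "Ws \<inter> U0 = (UNIV \<times> {0}) \<inter> U0" "Wcu \<inter> U0 = ({0} \<times> UNIV) \<inter> U0"
    and U1: "open U1" "p \<in> U1" "U0 \<inter> U1 = {}"
    and coords: "C1_diffeo_on U1 \<phi>" "\<phi> p = (yp, 0)"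
        "\<exists>r>0. \<forall>z. norm z \<le> r \<longrightarrow> (yp, z) \<in> \<phi> ` (wcu \<inter> U1)"
        "\<forall>x\<in>U1. x \<in> Ws \<longleftrightarrow> snd (\<phi> x) = 0"
    and eps_pos: "0 < ey0" "0 < ez0" "0 < ey1" "0 < ez1"
    and boxes: "cball 0 ey0 \<times> cball 0 ez0 \<subseteq> U0" "cball yp ey1 \<times> cball 0 ez1 \<subseteq> \<phi> ` U1"
  shows "\<exists>N. C1_disk CARD('u) N \<and> N \<subseteq> Wcu \<and> 0 \<in> N \<and>
    (\<forall>\<epsilon>>0. \<exists>m\<^sub>\<epsilon>::nat. \<forall>m\<ge>m\<^sub>\<epsilon>. \<forall>D\<in>admissible_disks U1 \<phi> yp ey0 ez0 ey1 ez1.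
       \<exists>h. C1_embedding N h \<and> h ` N \<subseteq> (F ^^ m) ` D \<and> C1_dist N h id < \<epsilon>)"
proof -
  obtain f g G L where G: "open G" "0 \<in> G" and f_C1: "C1_on UNIV f" and f_F: "\<forall>x\<in>G. f x = F x"
    and lip: "L-lipschitz_on UNIV (\<lambda>x. f x - map_prod B C x)" and gap: "4 * L < 1 / onorm (inv C) - onorm B"
    and inv: "f ` pseudohyperbolic_manifold f = pseudohyperbolic_manifold f"
    and Wcu_eq: "Wcu = pseudohyperbolic_manifold f \<inter> G"
    using Wcu unfolding local_center_unstable_manifold_def by blast
  obtain H V where H: "open H" "0 \<in> H" and V: "continuous_on H V" "\<forall>x\<in>H. (0::real) \<le> V x"
      "\<forall>x\<in>H. V x = 0 \<longleftrightarrow> x \<in> Ws" "\<forall>x\<in>H \<inter> F -` H. V x \<le> V (F x)"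
    using unstable unfolding strongly_conditionally_unstable_def by blast
  obtain F' where F': "continuous_on UNIV F'" "\<And>x. (F has_derivative blinfun_apply (F' x)) (at x)"
      "\<And>x. inj (blinfun_apply (F' x))"
    using C1_diffeo_on_derivative[OF F_diffeo(2)] by blast
  obtain f' where f': "continuous_on UNIV f'" "\<And>x. (f has_derivative blinfun_apply (f' x)) (at x)"
    using f_C1 unfolding C1_on_def by blast
  have F'0: "blinfun_apply (F' 0) = map_prod B C"
    using has_derivative_unique[OF F'(2) DF_0] .
  have "(f has_derivative map_prod B C) (at 0)"
    using has_derivative_transform_within_open[OF DF_0 G(1,2), of f] f_F by simp
  then have f'0: "blinfun_apply (f' 0) = map_prod B C"
    using has_derivative_unique[OF f'(2)] by blast
  have BC: "bounded_linear B" "bounded_linear C"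
    using bounded_linear_map_prodD[OF has_derivative_bounded_linear[OF DF_0]] by auto
  define a where "a = onorm B"
  define b where "b = 1 / onorm (inv C)"
  define \<kappa> where "\<kappa> = min ((b - a) / 8) ((1 - a) / 2)"
  have \<kappa>: "0 < \<kappa>" "a + \<kappa> < 1" "8 * \<kappa> \<le> b - a"
  proof -
    have ab: "a < 1" "a < b" using norms by (simp_all add: a_def b_def)
    have "\<kappa> \<le> (b - a) / 8" "\<kappa> \<le> (1 - a) / 2" 
      unfolding \<kappa>_def by (rule min.cobounded1, rule min.cobounded2)
    then have "8 * \<kappa> \<le> b - a" "2 * \<kappa> \<le> 1 - a" by simp_all
    with ab show "a + \<kappa> < 1" "8 * \<kappa> \<le> b - a" by linarith+
    show "0 < \<kappa>" using ab by (simp add: \<kappa>_def)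
  qed
  have f_cont: "continuous_on UNIV f"
    using f'(2) by (meson continuous_at_imp_continuous_on has_derivative_continuous)
  have f0: "f 0 = 0" using f_F G(2) F_0 by simp
  \<comment> \<open>\<open>f -` G\<close> is included since \<open>Wcu\<close> is invariant only as long as the image remains in \<open>G\<close>.\<close>
  define N where "N = G \<inter> H \<inter> U0 \<inter> f -` G \<inter> {x. norm (F' x - F' 0) < \<kappa>} \<inter> {x. norm (f' x - f' 0) < \<kappa>}"
  have "open N"
    unfolding N_def using G(1) H(1) U0(1) F'(1) f'(1) f_cont
    by (intro open_Int open_Collect_less open_vimage continuous_intros) auto
  moreover have "0 \<in> N" using G H U0 f0 \<kappa>(1) by (simp add: N_def)
  ultimately obtain r where r: "0 < r" "bidisk r \<subseteq> N" using open_contains_bidisk by blast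
  have in_N: "x \<in> G" "x \<in> H" "x \<in> U0" "f x \<in> G" "norm (F' x - F' 0) < \<kappa>" "norm (f' x - f' 0) < \<kappa>"
    if "x \<in> bidisk r" for x
    using that r(2) by (auto simp: N_def)
  have Ws_U0: "x \<in> Ws \<longleftrightarrow> snd x = 0" if "x \<in> U0" for x
    using U0(4) straight(1) that by (auto simp: mem_Times_iff)
  have Ws_iter: "snd ((F ^^ k) x) = 0" if "x \<in> Ws" for x k
    using subsetD[OF straight(1) local_stable_manifold_iterates(1)[OF Ws that]] by (simp add: mem_Times_iff)
  interpret saddle: straightened_saddle F f F' f' B C a b L r \<kappa> V
  proof
    show "norm (B y) \<le> a * norm y" for y unfolding a_def by (rule onorm[OF BC(1)])
    show "b * norm z \<le> norm (C z)" for z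
      unfolding b_def by (rule bij_linear_lower_bound[OF bounded_linear.linear[OF BC(2)] C_bij])
    show "0 \<le> a" unfolding a_def by (rule onorm_pos_le[OF BC(1)])
    show "4 * L < b - a" using gap by (simp add: a_def b_def)
    show "F x = f x" if "x \<in> bidisk r" for x using f_F in_N(1)[OF that] by simp
    show "norm (F' x v - map_prod B C v) \<le> \<kappa> * norm v" if "x \<in> bidisk r" for x v
      using order.trans[OF norm_blinfun mult_right_mono[OF less_imp_le[OF in_N(5)[OF that]] norm_ge_zero], of v]
      by (simp add: blinfun.diff_left F'0)
    show "norm (f' x v - map_prod B C v) \<le> \<kappa> * norm v" if "x \<in> bidisk r" for x v
      using order.trans[OF norm_blinfun mult_right_mono[OF less_imp_le[OF in_N(6)[OF that]] norm_ge_zero], of v]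
      by (simp add: blinfun.diff_left f'0)
    show "fst (f (0, z)) = 0" if "norm z \<le> r" for z
    proof -
      have z: "(0::real^'s, z) \<in> bidisk r" using that r(1) by (simp add: mem_bidisk)
      then have "(0, z) \<in> Wcu" using U0(5) in_N(3) by blast
      then have "f (0, z) \<in> pseudohyperbolic_manifold f" using inv Wcu_eq by blast
      then have "f (0, z) \<in> Wcu" using in_N(4)[OF z] Wcu_eq by blast
      from subsetD[OF straight(2) this] show ?thesis by (simp add: mem_Times_iff)
    qed
    show "snd (f (y, 0)) = 0" if "norm y \<le> r" for y
    proof -
      have y: "(y, 0::real^'u) \<in> bidisk r" using that r(1) by (simp add: mem_bidisk)
      then have "(y, 0) \<in> Ws" using Ws_U0[OF in_N(3)] by simp
      then show ?thesis using Ws_iter[of "(y, 0)" 1] f_F in_N(1)[OF y] by simp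
    qed
    show "continuous_on (bidisk r) V" using V(1) in_N(2) by (blast intro: continuous_on_subset)
    show "0 \<le> V x" if "x \<in> bidisk r" for x using V(2) in_N(2)[OF that] by blast
    show "V x = 0 \<longleftrightarrow> snd x = 0" if "x \<in> bidisk r" for x
      using V(3) in_N(2)[OF that] Ws_U0[OF in_N(3)[OF that]] by blast
    show "V x \<le> V (F x)" if "x \<in> bidisk r" "F x \<in> bidisk r" for x
      using V(4) in_N(2)[OF that(1)] in_N(2)[OF that(2)] by blast
  qed (use F' f' lip \<kappa> r BC in \<open>simp_all add: linear_simps\<close>)

  let ?\<psi> = "the_inv_into U1 \<phi>"
  have inj\<phi>: "inj_on \<phi> U1" "open (\<phi> ` U1)" using coords(1) by (auto simp: C1_diffeo_on_def)
  obtain \<psi>' where \<psi>': "continuous_on (\<phi> ` U1) \<psi>'"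
      "\<And>x. x \<in> \<phi> ` U1 \<Longrightarrow> (?\<psi> has_derivative blinfun_apply (\<psi>' x)) (at x)"
      "\<And>x. x \<in> \<phi> ` U1 \<Longrightarrow> inj (blinfun_apply (\<psi>' x))"
    using C1_diffeo_on_derivative[OF C1_diffeo_on_inverse[OF coords(1)]] by blast
  have \<psi>: "?\<psi> x \<in> U1" "\<phi> (?\<psi> x) = x" if "x \<in> \<phi> ` U1" for x
    using that inj\<phi>(1) by (auto simp: the_inv_into_f_f)
  have \<psi>_Ws: "?\<psi> (y, 0) \<in> Ws" if "(y, 0) \<in> \<phi> ` U1" for y
    using coords(4) \<psi>[OF that] by simp
  have "\<exists>\<rho>0>0. \<forall>\<rho>. 0 < \<rho> \<longrightarrow> \<rho> \<le> \<rho>0 \<longrightarrow> (\<forall>\<epsilon>>0. \<exists>m0. \<forall>m\<ge>m0. \<forall>\<eta>.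
      lipschitz_C1_graph 0 ey0 ez0 \<eta> \<longrightarrow>
      contains_close_disk \<rho> \<epsilon> ((F ^^ m) ` (\<lambda>x. x) ` (\<lambda>z. (\<eta> z, z)) ` cball 0 ez0))"
  proof (rule saddle.graphs_through_stable_set_accumulate[where \<Psi>' = "\<lambda>_. id_blinfun",
        OF U0(1) boxes(1) eps_pos(2)])
    fix y k assume "(y, 0) \<in> U0"
    then have "(y, 0) \<in> Ws" using Ws_U0 by simp
    then show "snd ((F ^^ k) (y, 0)) = 0" "(\<lambda>k. (F ^^ k) (y, 0)) \<longlonglongrightarrow> 0"
      using Ws_iter local_stable_manifold_iterates(2)[OF Ws] by blast+
  qed (auto simp: inj_on_def)
  then obtain \<rho>0 where \<rho>0: "0 < \<rho>0" "\<forall>\<rho>. 0 < \<rho> \<longrightarrow> \<rho> \<le> \<rho>0 \<longrightarrow> (\<forall>\<epsilon>>0. \<exists>m0. \<forall>m\<ge>m0. \<forall>\<eta>.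
      lipschitz_C1_graph 0 ey0 ez0 \<eta> \<longrightarrow>
      contains_close_disk \<rho> \<epsilon> ((F ^^ m) ` (\<lambda>z. (\<eta> z, z)) ` cball 0 ez0))"
    unfolding image_ident by blast
  have "\<exists>\<rho>0>0. \<forall>\<rho>. 0 < \<rho> \<longrightarrow> \<rho> \<le> \<rho>0 \<longrightarrow> (\<forall>\<epsilon>>0. \<exists>m0. \<forall>m\<ge>m0. \<forall>\<eta>.
      lipschitz_C1_graph yp ey1 ez1 \<eta> \<longrightarrow>
      contains_close_disk \<rho> \<epsilon> ((F ^^ m) ` ?\<psi> ` (\<lambda>z. (\<eta> z, z)) ` cball 0 ez1))"
    by (rule saddle.graphs_through_stable_set_accumulate[OF inj\<phi>(2) boxes(2) eps_pos(4) \<psi>'(2,1,3)])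
      (use \<psi>_Ws Ws_iter local_stable_manifold_iterates(2)[OF Ws] in blast)+
  then obtain \<rho>1 where \<rho>1: "0 < \<rho>1" "\<forall>\<rho>. 0 < \<rho> \<longrightarrow> \<rho> \<le> \<rho>1 \<longrightarrow> (\<forall>\<epsilon>>0. \<exists>m0. \<forall>m\<ge>m0. \<forall>\<eta>.
      lipschitz_C1_graph yp ey1 ez1 \<eta> \<longrightarrow>
      contains_close_disk \<rho> \<epsilon> ((F ^^ m) ` ?\<psi> ` (\<lambda>z. (\<eta> z, z)) ` cball 0 ez1))"
    by blast

  define \<rho> where "\<rho> = min (min \<rho>0 \<rho>1) r"
  have \<rho>: "0 < \<rho>" "\<rho> \<le> \<rho>0" "\<rho> \<le> \<rho>1" "\<rho> \<le> r" using \<rho>0(1) \<rho>1(1) r(1) by (auto simp: \<rho>_def)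
  have eventually_close: "\<exists>m0. \<forall>m\<ge>m0. \<forall>D\<in>admissible_disks U1 \<phi> yp ey0 ez0 ey1 ez1.
      contains_close_disk \<rho> \<epsilon> ((F ^^ m) ` D)" if "0 < \<epsilon>" for \<epsilon>
  proof -
    obtain m0 where m0: "\<forall>m\<ge>m0. \<forall>\<eta>. lipschitz_C1_graph 0 ey0 ez0 \<eta> \<longrightarrow>
        contains_close_disk \<rho> \<epsilon> ((F ^^ m) ` (\<lambda>z. (\<eta> z, z)) ` cball 0 ez0)"
      using \<rho>0(2) \<rho>(1,2) \<open>0 < \<epsilon>\<close> by blast
    obtain m1 where m1: "\<forall>m\<ge>m1. \<forall>\<eta>. lipschitz_C1_graph yp ey1 ez1 \<eta> \<longrightarrow>
        contains_close_disk \<rho> \<epsilon> ((F ^^ m) ` ?\<psi> ` (\<lambda>z. (\<eta> z, z)) ` cball 0 ez1)"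
      using \<rho>1(2) \<rho>(1,3) \<open>0 < \<epsilon>\<close> by blast
    show ?thesis
    proof (intro exI[of _ "max m0 m1"] allI impI ballI)
      fix m D assume "max m0 m1 \<le> m" and "D \<in> admissible_disks U1 \<phi> yp ey0 ez0 ey1 ez1"
      then have m: "m0 \<le> m" "m1 \<le> m" and "D \<in> graph_disks 0 ey0 ez0 \<or>
          (\<exists>d\<in>graph_disks yp ey1 ez1. D = {x \<in> U1. \<phi> x \<in> d})"
        unfolding admissible_disks_def by auto
      then consider "D \<in> graph_disks 0 ey0 ez0"
        | d where "d \<in> graph_disks yp ey1 ez1" "D = {x \<in> U1. \<phi> x \<in> d}"
        by blast
      then show "contains_close_disk \<rho> \<epsilon> ((F ^^ m) ` D)"
      proof cases
        case 1
        then obtain \<eta> where "D = (\<lambda>z. (\<eta> z, z)) ` cball 0 ez0" "lipschitz_C1_graph 0 ey0 ez0 \<eta>"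
          by (rule graph_disksE)
        then show ?thesis using m0 m(1) by blast
      next
        case (2 d)
        obtain \<eta> where d: "d = (\<lambda>z. (\<eta> z, z)) ` cball 0 ez1" and \<eta>: "lipschitz_C1_graph yp ey1 ez1 \<eta>"
          using 2(1) by (rule graph_disksE)
        have "d \<subseteq> \<phi> ` U1" using boxes(2) \<eta> unfolding d lipschitz_C1_graph_def by blast
        then have "?\<psi> x \<in> D" if "x \<in> d" for x
          using that \<psi>[of x] unfolding 2(2) by (simp add: subsetD)
        then have "?\<psi> ` d \<subseteq> D" by blast
        then have "(F ^^ m) ` ?\<psi> ` d \<subseteq> (F ^^ m) ` D" by (rule image_mono)
        moreover have "contains_close_disk \<rho> \<epsilon> ((F ^^ m) ` ?\<psi> ` d)"
          using m1 m(2) \<eta> unfolding d by blast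
        ultimately show ?thesis by (blast intro: contains_close_disk_mono)
      qed
    qed
  qed
  let ?N = "{0} \<times> cball 0 \<rho> :: (('s, 'u) phase) set"
  have "C1_disk CARD('u) ?N" by (rule C1_disk_vertical[OF \<rho>(1)])
  moreover have "0 \<in> ?N" using \<rho>(1) by (simp add: zero_prod_def)
  moreover have "?N \<subseteq> Wcu"
  proof -
    have "?N \<subseteq> bidisk r" using \<rho>(4) r(1) by (auto simp: mem_bidisk)
    then show ?thesis using U0(5) in_N(3) by blast
  qed
  ultimately show ?thesis
    using eventually_close unfolding contains_close_disk_def by (intro exI[of _ ?N]) auto
qed

end
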